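(* Let $P$ be a nonempty nowhere locally compact Polish space, and let $\mathcal S$ be a nonmeager-bounding semifilter such that $\mathfrak b(\mathcal S)=\mathfrak d$. Then there is a subspace $X$ of $P$ such that: (1) all finite powers of $X$ have Menger's property, (2) $X$ satisfies $\mathbf B(\mathcal S)$, and (3) $X$ does not have the Hurewicz property.
   Context: A space is nowhere locally compact if no point has a compact neighborhood. $\mathbb N=\{0,1,2,\dots\}$, discrete; $\mathbb N^{\mathbb N}$ has the product topology. $[\mathbb N]^{\aleph_0}$ is the family of infinite subsets of $\mathbb N$; $A\subseteq^*B$ means $A\setminus B$ is finite. A semifilter is a nonempty $\mathcal F\subseteq[\mathbb N]^{\aleph_0}$ such that $A\in\mathcal F$, $B\subseteq\mathbb N$ and $A\subseteq^*B$ imply $B\in\mathcal F$. For $f,g\in\mathbb N^{\mathbb N}$, $f\le_{\mathcal F}g$ means $\{n:f(n)\le g(n)\}\in\mathcal F$, and $f\le^*g$ means $f(n)\le g(n)$ for all but finitely many $n$. A set $Y\subseteq\mathbb N^{\mathbb N}$ is bounded with respect to such a relation $R$ if there is $g\in\mathbb N^{\mathbb N}$ with $f\,R\,g$ for all $f\in Y$; otherwise it is unbounded. $\mathfrak b(\mathcal F)$ is the minimal cardinality of a subset of $\mathbb N^{\mathbb N}$ unbounded with respect to $\le_{\mathcal F}$. A set $D\subseteq\mathbb N^{\mathbb N}$ is dominating if each $g\in\mathbb N^{\mathbb N}$ satisfies $g\le^*f$ for some $f\in D$; $\mathfrak d$ is the minimal cardinality of a dominating set. A space satisfies $\mathbf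 B(\mathcal F)$ if each of its continuous images in $\mathbb N^{\mathbb N}$ is bounded with respect to $\le_{\mathcal F}$. It has Menger's property if no continuous image of it in $\mathbb N^{\mathbb N}$ is dominating (equivalently, it satisfies $\mathbf B([\mathbb N]^{\aleph_0})$). It has the Hurewicz property if each of its continuous images in $\mathbb N^{\mathbb N}$ is bounded with respect to $\le^*$. $\mathbb N^{\uparrow\mathbb N}$ is the subspace of (strictly) increasing elements of $\mathbb N^{\mathbb N}$. A semifilter $\mathcal S$ is nonmeager-bounding if for each $Y\subseteq\mathbb N^{\mathbb N}$ with $|Y|<\mathfrak b(\mathcal S)$, the set $\{g\in\mathbb N^{\uparrow\mathbb N}:(\forall f\in Y)\ f\le_{\mathcal S}g\}$ is nonmeager (in $\mathbb N^{\uparrow\mathbb N}$). *)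

theory Defs
  imports "HOL-Analysis.Analysis"
begin

unbundle cardinal_syntax

definition polish :: "'a topology \<Rightarrow> bool" where
  "polish X \<longleftrightarrow> separable_space X \<and> completely_metrizable_space X"

definition nowhere_locally_compact :: "'a topology \<Rightarrow> bool" where
  "nowhere_locally_compact X \<longleftrightarrow>
     (\<forall>x\<in>topspace X. \<not> (\<exists>U K. openin X U \<and> compactin X K \<and> x \<in> U \<and> U \<subseteq> K))"

definition nowhere_dense_in :: "'a topology \<Rightarrow> 'a set \<Rightarrow> bool" where
  "nowhere_dense_in X A \<longleftrightarrow> A \<subseteq> topspace X \<and> X interior_of (X closure_of A) = {}"

definition meager_in :: "'a topology \<Rightarrow> 'a set \<Rightarrow> bool" where
  "meager_in X A \<longleftrightarrow> (\<exists>\<N>. countable \<N> \<and> (\<forall>N\<in>\<N>. nowhere_dense_in X N) \<and> A = \<Union>\<N>)"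

definition power_topology :: "'a topology \<Rightarrow> nat \<Rightarrow> (nat \<Rightarrow> 'a) topology" where
  "power_topology X n = product_topology (\<lambda>_. X) {..<n}"

definition baire_space :: "(nat \<Rightarrow> nat) topology" where
  "baire_space = product_topology (\<lambda>_. discrete_topology UNIV) UNIV"

definition increasing_baire_space :: "(nat \<Rightarrow> nat) topology" where
  "increasing_baire_space = subtopology baire_space {g. strict_mono g}"

definition almost_subset :: "nat set \<Rightarrow> nat set \<Rightarrow> bool" where
  "almost_subset A B \<longleftrightarrow> finite (A - B)"

definition semifilter :: "nat set set \<Rightarrow> bool" where
  "semifilter \<F> \<longleftrightarrow> \<F> \<noteq> {} \<and> (\<forall>A\<in>\<F>. infinite A) \<and>
     (\<forall>A B. A \<in> \<F> \<and> almost_subset A B \<longrightarrow> B \<in> \<F>)"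

definition le_sf :: "nat set set \<Rightarrow> (nat \<Rightarrow> nat) \<Rightarrow> (nat \<Rightarrow> nat) \<Rightarrow> bool" where
  "le_sf \<F> f g \<longleftrightarrow> {n. f n \<le> g n} \<in> \<F>"

definition le_star :: "(nat \<Rightarrow> nat) \<Rightarrow> (nat \<Rightarrow> nat) \<Rightarrow> bool" where
  "le_star f g \<longleftrightarrow> (\<forall>\<^sub>F n in cofinite. f n \<le> g n)"

definition bounded_wrt ::
    "((nat \<Rightarrow> nat) \<Rightarrow> (nat \<Rightarrow> nat) \<Rightarrow> bool) \<Rightarrow> (nat \<Rightarrow> nat) set \<Rightarrow> bool" where
  "bounded_wrt R Y \<longleftrightarrow> (\<exists>g. \<forall>f\<in>Y. R f g)"

definition dominating :: "(nat \<Rightarrow> nat) set \<Rightarrow> bool" where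
  "dominating D \<longleftrightarrow> (\<forall>g. \<exists>f\<in>D. le_star g f)"

text \<open>
  The minimal cardinality of a set satisfying \<open>P\<close>, as a cardinal in the sense of the library
  (a well-order compared by \<open>=o\<close>, \<open>\<le>o\<close> and \<open><o\<close>). Different minimizing sets give cardinals
  that are equal only up to \<open>=o\<close>, so equality of invariants must be expressed by \<open>=o\<close>.
\<close>

definition min_card :: "('a set \<Rightarrow> bool) \<Rightarrow> 'a rel" where
  "min_card P = (SOME \<kappa>. \<exists>A. P A \<and> \<kappa> = |A| \<and> (\<forall>B. P B \<longrightarrow> |A| \<le>o |B| ))"

lemma min_card_attained:
  assumes "P B"
  obtains A where "P A" "min_card P = |A|" "\<And>C. P C \<Longrightarrow> |A| \<le>o |C|"
proof -
  have "\<exists>r\<in>card_of ` Collect P. \<forall>r'\<in>card_of ` Collect P. r \<le>o r'"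
    by (rule exists_minim_Well_order) (use assms in \<open>auto simp: card_of_Well_order\<close>)
  then have "\<exists>\<kappa> A. P A \<and> \<kappa> = |A| \<and> (\<forall>C. P C \<longrightarrow> |A| \<le>o |C| )"
    by auto
  from someI_ex[OF this] show ?thesis
    using that unfolding min_card_def by blast
qed

definition bounding_number :: "nat set set \<Rightarrow> (nat \<Rightarrow> nat) rel" where
  "bounding_number \<F> = min_card (\<lambda>Y. \<not> bounded_wrt (le_sf \<F>) Y)"

definition dominating_number :: "(nat \<Rightarrow> nat) rel" where
  "dominating_number = min_card dominating"

lemma unbounded_UNIV:
  assumes "semifilter \<F>"
  shows "\<not> bounded_wrt (le_sf \<F>) UNIV"
proof
  assume "bounded_wrt (le_sf \<F>) UNIV"
  then obtain g where g: "\<And>f. le_sf \<F> f g"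
    by (auto simp: bounded_wrt_def)
  have "{} \<in> \<F>"
    using g[of "\<lambda>n. Suc (g n)"] by (simp add: le_sf_def)
  then show False
    using assms by (auto simp: semifilter_def)
qed

lemma dominating_UNIV: "dominating UNIV"
  unfolding dominating_def le_star_def by (intro allI bexI[OF _ UNIV_I]) (rule always_eventually, rule allI, rule order_refl)

definition nonmeager_bounding :: "nat set set \<Rightarrow> bool" where
  "nonmeager_bounding \<S> \<longleftrightarrow> semifilter \<S> \<and>
     (\<forall>Y :: (nat \<Rightarrow> nat) set. |Y| <o bounding_number \<S> \<longrightarrow>
        \<not> meager_in increasing_baire_space {g. strict_mono g \<and> (\<forall>f\<in>Y. le_sf \<S> f g)})"

definition satisfies_B :: "nat set set \<Rightarrow> 'a topology \<Rightarrow> bool" where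
  "satisfies_B \<F> X \<longleftrightarrow>
     (\<forall>\<phi>. continuous_map X baire_space \<phi> \<longrightarrow> bounded_wrt (le_sf \<F>) (\<phi> ` topspace X))"

definition menger :: "'a topology \<Rightarrow> bool" where
  "menger X \<longleftrightarrow> (\<forall>\<phi>. continuous_map X baire_space \<phi> \<longrightarrow> \<not> dominating (\<phi> ` topspace X))"

definition hurewicz :: "'a topology \<Rightarrow> bool" where
  "hurewicz X \<longleftrightarrow>
     (\<forall>\<phi>. continuous_map X baire_space \<phi> \<longrightarrow> bounded_wrt le_star (\<phi> ` topspace X))"

end

theory Submission
  imports Defs
begin

text \<open>
  Since \<open>P\<close> has no isolated points, it contains a copy of the Cantor space, whose points are read as
  subsets of \<open>\<nat>\<close>; it suffices to find \<open>X\<close> there. If some \<open>\<le>\<^sup>*\<close>-unbounded family has fewer than \<open>d\<close>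
  members, the sets whose complements it enumerates form a suitable \<open>X\<close>, because \<open>X\<close> is too small
  to have a dominating or \<open>\<le>\<^sub>\<S>\<close>-unbounded image.

  Otherwise every family of fewer than \<open>d\<close> functions is \<open>\<le>\<^sup>*\<close>-bounded. Fix a scale \<open>z\<^sub>a\<close> of length
  \<open>d\<close> and let \<open>X\<close> consist of the finite sets and the ranges of increasing functions \<open>f\<^sub>a\<close> with
  \<open>z\<^sub>a \<le>\<^sub>\<S> f\<^sub>a\<close>, chosen recursively so that the sets \<open>{n. z\<^sub>a n \<le> f\<^sub>a n}\<close> have the finite
  intersection property. For a previous finite intersection \<open>B\<close> it is enough that \<open>f\<^sub>a\<close> exceeds
  \<open>n \<mapsto> z\<^sub>a (min {m \<in> B. n \<le> m})\<close> infinitely often, because \<open>f\<^sub>a\<close> is increasing. As \<open>f\<^sub>a\<close> ranges over a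
  nonmeager set, the complement of its range can be made to have an enumeration not dominated by
  the \<open>a\<close>-th member of a dominating family, which destroys the Hurewicz property. By compactness,
  the image of \<open>x \<in> X\<^sup>n\<close> under a continuous map is bounded by a fixed \<open>g\<close> at each place where all
  coordinates, as increasing sequences, exceed \<open>g\<close>; for all but fewer than \<open>d\<close> values of the
  coordinates this happens infinitely often, and the exceptional values are removed by induction
  on \<open>n\<close>.
\<close>

section \<open>Sequences of discrete values\<close>

abbreviation sequence_space :: "(nat \<Rightarrow> 'b) topology" where
  "sequence_space \<equiv> product_topology (\<lambda>_. discrete_topology UNIV) UNIV"

lemma openin_sequence_space:
  "openin sequence_space (U :: (nat \<Rightarrow> 'b) set) \<longleftrightarrow>
     (\<forall>x\<in>U. \<exists>k. \<forall>y. (\<forall>i<k. y i = x i) \<longrightarrow> y \<in> U)" (is "?L \<longleftrightarrow> ?R")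
proof
  assume L: ?L
  show ?R
  proof
    fix x assume "x \<in> U"
    with L obtain V where V: "finite {i. V i \<noteq> UNIV}" "x \<in> PiE UNIV V" "PiE UNIV V \<subseteq> U"
      by (auto simp: openin_product_topology_alt)
    then obtain k where k: "\<forall>i\<in>{i. V i \<noteq> UNIV}. i < k"
      using finite_nat_set_iff_bounded by blast
    have "y \<in> U" if "\<forall>i<k. y i = x i" for y
    proof -
      have "y i \<in> V i" for i
        using that k V(2) by (cases "V i = UNIV") (auto simp: PiE_iff)
      then show ?thesis using V(3) by (auto simp: PiE_iff)
    qed
    then show "\<exists>k. \<forall>y. (\<forall>i<k. y i = x i) \<longrightarrow> y \<in> U" by blast
  qed
next
  assume R: ?R
  show ?L
    unfolding openin_product_topology_alt
  proof (intro ballI)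
    fix x assume "x \<in> U"
    with R obtain k where k: "\<And>y. (\<forall>i<k. y i = x i) \<Longrightarrow> y \<in> U" by blast
    let ?V = "\<lambda>i. if i < k then {x i} else UNIV"
    have "finite {i. ?V i \<noteq> UNIV}"
      by (rule finite_subset[of _ "{..<k}"]) auto
    moreover have "x \<in> PiE UNIV ?V" "PiE UNIV ?V \<subseteq> U"
      using k by (auto simp: PiE_iff split: if_splits)
    ultimately show "\<exists>V. finite {i \<in> UNIV. V i \<noteq> topspace (discrete_topology UNIV)} \<and>
        (\<forall>i\<in>UNIV. openin (discrete_topology UNIV) (V i)) \<and> x \<in> PiE UNIV V \<and> PiE UNIV V \<subseteq> U"
      by (intro exI[of _ ?V]) auto
  qed
qed

lemma openin_cylinder: "openin sequence_space {y. \<forall>i<k. y i = x i}"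
  unfolding openin_sequence_space by (auto intro!: exI[of _ k])

lemma continuous_map_sequence_space:
  "continuous_map X sequence_space \<phi> \<longleftrightarrow>
     (\<forall>n. continuous_map X (discrete_topology UNIV) (\<lambda>x. \<phi> x n))"
  by (simp add: continuous_map_componentwise_UNIV)

lemma continuous_map_locally_constant:
  assumes "\<And>x. x \<in> A \<Longrightarrow> \<exists>k. \<forall>y\<in>A. (\<forall>i<k. y i = x i) \<longrightarrow> \<psi> y = \<psi> x"
  shows "continuous_map (subtopology sequence_space A) (discrete_topology UNIV) \<psi>"
  unfolding continuous_map_def
proof (intro conjI allI impI)
  fix U
  show "openin (subtopology sequence_space A) {x \<in> topspace (subtopology sequence_space A). \<psi> x \<in> U}"
    (is "openin ?X ?S")
  proof (subst openin_subopen, intro ballI)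
    fix x assume "x \<in> ?S"
    then have x: "x \<in> A" "\<psi> x \<in> U" by auto
    obtain k where k: "\<And>y. y \<in> A \<Longrightarrow> (\<forall>i<k. y i = x i) \<Longrightarrow> \<psi> y = \<psi> x"
      using assms[OF x(1)] by blast
    have "{y. \<forall>i<k. y i = x i} \<inter> A \<subseteq> ?S"
    proof
      fix y assume "y \<in> {y. \<forall>i<k. y i = x i} \<inter> A"
      then show "y \<in> ?S" using k[of y] x by auto
    qed
    moreover have "openin ?X ({y. \<forall>i<k. y i = x i} \<inter> A)"
      using openin_cylinder by (rule openin_subtopology_Int)
    ultimately show "\<exists>T. openin ?X T \<and> x \<in> T \<and> T \<subseteq> ?S"
      using x by blast
  qed
qed auto

lemma compact_cantor: "compact_space (sequence_space :: (nat \<Rightarrow> bool) topology)"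
  by (simp add: compact_space_product_topology compact_space_discrete_topology)

text \<open>Neighbourhoods in the space of increasing functions are controlled by finite initial
  segments. If the closure of \<open>A\<close> contained a neighbourhood of \<open>g\<close>, it
  would contain the prescribed extension \<open>h\<close>, although a whole cylinder around
  \<open>h\<close> misses \<open>A\<close>.\<close>

lemma nowhere_dense_in_increasing:
  assumes "A \<subseteq> {g. strict_mono g}"
    and ext: "\<And>g k. strict_mono g \<Longrightarrow>
      \<exists>h k'. strict_mono h \<and> (\<forall>i<k. h i = g i) \<and>
        (\<forall>u. strict_mono u \<longrightarrow> (\<forall>i<k'. u i = h i) \<longrightarrow> u \<notin> A)"
  shows "nowhere_dense_in increasing_baire_space A"
  unfolding nowhere_dense_in_def
proof
  let ?T = "increasing_baire_space"
  have top: "topspace ?T = {g. strict_mono g}"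
    by (auto simp: increasing_baire_space_def baire_space_def)
  show "A \<subseteq> topspace ?T" using assms(1) top by simp
  show "?T interior_of (?T closure_of A) = {}"
  proof (rule ccontr)
    assume "?T interior_of (?T closure_of A) \<noteq> {}"
    then obtain g U where U: "openin ?T U" "g \<in> U" "U \<subseteq> ?T closure_of A"
      by (auto simp: interior_of_def)
    from U(1) obtain V where V: "openin sequence_space V" "U = V \<inter> {g. strict_mono g}"
      unfolding increasing_baire_space_def baire_space_def openin_subtopology by blast
    with U have g: "strict_mono g" "g \<in> V" by auto
    obtain k where k: "\<And>y. (\<forall>i<k. y i = g i) \<Longrightarrow> y \<in> V"
      using V(1) g(2) unfolding openin_sequence_space by blast
    obtain h k' where h: "strict_mono h" "\<forall>i<k. h i = g i"
      "\<And>u. strict_mono u \<Longrightarrow> (\<forall>i<k'. u i = h i) \<Longrightarrow> u \<notin> A"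
      using ext[OF g(1), of k] by blast
    have "h \<in> U" unfolding V(2) using h(1) k[OF h(2)] by blast
    then have "h \<in> ?T closure_of A" using U(3) by (rule subsetD[rotated])
    moreover have "openin ?T ({y. \<forall>i<k'. y i = h i} \<inter> {g. strict_mono g})"
      unfolding increasing_baire_space_def baire_space_def openin_subtopology
      using openin_cylinder by blast
    ultimately obtain u where "u \<in> A" "\<forall>i<k'. u i = h i" "strict_mono u"
      using h(1) unfolding in_closure_of by (elim conjE allE[of _ "{y. \<forall>i<k'. y i = h i} \<inter> {g. strict_mono g}"]) auto
    with h(3) show False by blast
  qed
qed

text \<open>Since \<open>meager_in\<close> asks for equality with a countable union, the covering
  sets are first cut down to \<open>B\<close>.\<close>

lemma meager_in_subset:
  assumes "B \<subseteq> (\<Union>N::nat. C N)" "\<And>N. nowhere_dense_in X (C N)"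
  shows "meager_in X B"
proof -
  have nd: "nowhere_dense_in X (B \<inter> C N)" for N
  proof -
    have "X interior_of (X closure_of (B \<inter> C N)) \<subseteq> X interior_of (X closure_of (C N))"
      by (intro interior_of_mono closure_of_mono) auto
    then show ?thesis using assms(2)[of N] by (auto simp: nowhere_dense_in_def)
  qed
  show ?thesis unfolding meager_in_def
    by (rule exI[of _ "range (\<lambda>N. B \<inter> C N)"]) (use nd assms(1) in auto)
qed

text \<open>The sets where \<open>\<phi>\<close> is at most \<open>k\<close> are traces on
  \<open>X\<close> of open sets \<open>W k\<close> of \<open>C\<close>. These cover the intersection
  of the \<open>F m\<close>, and the complements of the \<open>F m\<close> cover the rest.
  Compactness leaves finitely many sets; beyond their largest index \<open>m\<close>, the set
  \<open>F m\<close> misses all the chosen complements and is covered by the chosen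
  \<open>W k\<close>.\<close>

lemma locally_bounded_near_compact:
  fixes \<phi> :: "'b \<Rightarrow> nat"
  assumes C: "compact_space C" and F: "\<And>m. closedin C (F m)" "decseq F" "(\<Inter>m. F m) \<subseteq> X"
    and \<phi>: "continuous_map (subtopology C X) (discrete_topology UNIV) \<phi>"
  shows "\<exists>m. \<forall>x\<in>topspace C \<inter> X \<inter> F m. \<phi> x \<le> m"
proof -
  have "\<exists>W. openin C W \<and> {x \<in> topspace (subtopology C X). \<phi> x \<in> {..k}} = W \<inter> X" for k
  proof -
    have "openin (subtopology C X) {x \<in> topspace (subtopology C X). \<phi> x \<in> {..k}}"
      by (rule openin_continuous_map_preimage[OF \<phi>]) simp
    then show ?thesis unfolding openin_subtopology by blast
  qed
  then obtain W where W: "\<And>k. openin C (W k)"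
    "\<And>k. {x \<in> topspace (subtopology C X). \<phi> x \<in> {..k}} = W k \<inter> X"
    by metis
  define V where "V m = topspace C - F m" for m
  have V: "openin C (V m)" for m using F(1) by (auto simp: V_def)
  have "topspace C \<subseteq> \<Union>(range W \<union> range V)"
  proof
    fix x assume x: "x \<in> topspace C"
    show "x \<in> \<Union>(range W \<union> range V)"
    proof (cases "x \<in> (\<Inter>m. F m)")
      case True
      then have "x \<in> W (\<phi> x) \<inter> X" unfolding W(2)[symmetric] using x F(3) by auto
      then show ?thesis by blast
    next
      case False
      then show ?thesis using x by (auto simp: V_def)
    qed
  qed
  moreover have "\<forall>G\<in>range W \<union> range V. openin C G" using W(1) V by blast
  ultimately obtain \<F> where \<F>: "finite \<F>" "\<F> \<subseteq> range W \<union> range V" "topspace C \<subseteq> \<Union>\<F>"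
    using C[unfolded compact_space_alt, THEN spec, of "range W \<union> range V"] by blast
  \<comment> \<open>An index for each member of the subcover, whichever of the two families it comes
    from; one maximum then bounds the indices of both kinds.\<close>
  define J where "J G = (SOME m. G = W m \<or> G = V m)" for G
  have J: "G = W (J G) \<or> G = V (J G)" if "G \<in> \<F>" for G
    unfolding J_def by (rule someI_ex) (use \<F>(2) that in auto)
  define m where "m = Max (insert 0 (J ` \<F>))"
  have m: "J G \<le> m" if "G \<in> \<F>" for G
    using that \<F>(1) by (auto simp: m_def)
  have "\<phi> x \<le> m" if x: "x \<in> topspace C" "x \<in> X" "x \<in> F m" for x
  proof -
    obtain G where G: "G \<in> \<F>" "x \<in> G" using \<F>(3) x(1) by blast
    have "x \<in> F (J G)" using m[OF G(1)] x(3) F(2) by (auto simp: decseq_def)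
    then have "x \<notin> V (J G)" by (auto simp: V_def)
    then have "x \<in> W (J G) \<inter> X" using J[OF G(1)] G(2) x(2) by blast
    then have "\<phi> x \<le> J G" unfolding W(2)[symmetric] by auto
    then show ?thesis using m[OF G(1)] by simp
  qed
  then show ?thesis by blast
qed

section \<open>Enumerating sets of natural numbers\<close>

text \<open>Counting starts at 0. The counting function is used because comparing the value with
  \<open>m\<close> then involves only the part of \<open>a\<close> up to \<open>m\<close>, which is
  what continuity needs. If \<open>a\<close> has at most \<open>n\<close> elements, no
  \<open>m\<close> qualifies and the value carries no meaning.\<close>

definition enum :: "nat set \<Rightarrow> nat \<Rightarrow> nat" where
  "enum a n = (LEAST m. n < card (a \<inter> {..<Suc m}))"

lemma infinite_imp_card_initial_gt:
  fixes a :: "nat set"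
  assumes "infinite a"
  shows "\<exists>m. n < card (a \<inter> {..<m})"
proof -
  obtain b where b: "finite b" "card b = Suc n" "b \<subseteq> a"
    using infinite_arbitrarily_large[OF assms] by blast
  then obtain m where "b \<subseteq> {..<m}"
    using finite_nat_iff_bounded by blast
  then have "card b \<le> card (a \<inter> {..<m})"
    using b by (intro card_mono) auto
  then show ?thesis using b by (intro exI[of _ m]) auto
qed

lemma enum_le_iff:
  assumes "infinite a"
  shows "enum a n \<le> m \<longleftrightarrow> n < card (a \<inter> {..<Suc m})"
proof
  obtain k where "n < card (a \<inter> {..<k})"
    using infinite_imp_card_initial_gt[OF assms] by blast
  also have "\<dots> \<le> card (a \<inter> {..<Suc k})" by (intro card_mono) auto
  finally have "n < card (a \<inter> {..<Suc (enum a n)})"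
    unfolding enum_def by (rule LeastI)
  also assume "enum a n \<le> m"
  then have "card (a \<inter> {..<Suc (enum a n)}) \<le> card (a \<inter> {..<Suc m})"
    by (intro card_mono) auto
  finally show "n < card (a \<inter> {..<Suc m})" .
next
  assume "n < card (a \<inter> {..<Suc m})"
  then show "enum a n \<le> m" unfolding enum_def by (rule Least_le)
qed

text \<open>Translates lower bounds on an increasing function into upper bounds on the size of
  initial parts of its range, the form in which compactness is exploited later.\<close>

lemma card_range_initial_gt_iff:
  fixes f :: "nat \<Rightarrow> nat"
  assumes "strict_mono f"
  shows "n < card (range f \<inter> {..<m}) \<longleftrightarrow> f n < m"
proof
  assume n: "n < card (range f \<inter> {..<m})"
  show "f n < m"
  proof (rule ccontr)
    assume "\<not> f n < m"
    then have "i < n" if "f i < m" for i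
      using that strict_mono_less[OF assms, of i n] by linarith
    then have "range f \<inter> {..<m} \<subseteq> f ` {..<n}" by blast
    then have "card (range f \<inter> {..<m}) \<le> card {..<n}"
      by (rule surj_card_le[rotated]) simp
    with n show False by simp
  qed
next
  assume "f n < m"
  then have "f i < m" if "i \<le> n" for i
    using that strict_mono_less_eq[OF assms, of i n] by linarith
  then have "f ` {..n} \<subseteq> range f \<inter> {..<m}" by blast
  then have "card (f ` {..n}) \<le> card (range f \<inter> {..<m})"
    by (intro card_mono) auto
  moreover have "card (f ` {..n}) = Suc n"
    using card_image[OF inj_on_subset[OF strict_mono_imp_inj_on[OF assms] subset_UNIV]] by simp
  ultimately show "n < card (range f \<inter> {..<m})" by simp
qed

lemma enum_range:
  assumes "strict_mono f"
  shows "enum (range f) n = f n"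
proof -
  have "enum (range f) n = (LEAST m. f n < Suc m)"
    unfolding enum_def card_range_initial_gt_iff[OF assms] ..
  also have "\<dots> = f n" by (rule Least_equality) auto
  finally show ?thesis .
qed

lemma continuous_map_enum_complement:
  assumes "\<And>x. x \<in> A \<Longrightarrow> infinite (- Collect x)"
  shows "continuous_map (subtopology sequence_space A) baire_space (\<lambda>x. enum (- Collect x))"
  unfolding baire_space_def continuous_map_sequence_space
proof (intro allI continuous_map_locally_constant)
  fix n x assume x: "x \<in> A"
  let ?M = "enum (- Collect x) n"
  have "enum (- Collect y) n = ?M" if y: "y \<in> A" "\<forall>i<Suc ?M. y i = x i" for y
  proof -
    have eq: "enum (- Collect y) n \<le> m \<longleftrightarrow> ?M \<le> m" if "m \<le> ?M" for m
    proof -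
      have "- Collect y \<inter> {..<Suc m} = - Collect x \<inter> {..<Suc m}"
        using y(2) that by auto
      then show ?thesis
        using assms x y(1) by (simp add: enum_le_iff)
    qed
    show ?thesis
      using eq[of ?M] eq[of "enum (- Collect y) n"] by simp
  qed
  then show "\<exists>k. \<forall>y\<in>A. (\<forall>i<k. y i = x i) \<longrightarrow> enum (- Collect y) n = ?M"
    by blast
qed

text \<open>As \<open>i \<le> g i\<close>, only arguments up to \<open>n\<close> can produce the
  value \<open>n\<close>; hence finite initial segments of \<open>g\<close> decide initial segments
  of its range.\<close>

lemma strict_mono_mem_range_iff:
  fixes g :: "nat \<Rightarrow> nat"
  assumes "strict_mono g"
  shows "n \<in> range g \<longleftrightarrow> n \<in> g ` {..n}"
proof
  assume "n \<in> range g"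
  then obtain i where i: "n = g i" by blast
  then have "i \<le> n" using strict_mono_imp_increasing[OF assms, of i] by simp
  with i show "n \<in> g ` {..n}" by blast
qed blast

lemma mem_range_initial_cong:
  fixes g u :: "nat \<Rightarrow> nat"
  assumes "strict_mono g" "strict_mono u" "\<forall>i<m. u i = g i" "n < m"
  shows "n \<in> range u \<longleftrightarrow> n \<in> range g"
proof -
  have "u ` {..n} = g ` {..n}" using assms(3,4) by (intro image_cong) auto
  then show ?thesis using strict_mono_mem_range_iff assms(1,2) by simp
qed

lemma complement_range_initial_cong:
  fixes g u :: "nat \<Rightarrow> nat"
  assumes "strict_mono g" "strict_mono u" "\<forall>i<m. u i = g i"
  shows "- range u \<inter> {..<m} = - range g \<inter> {..<m}"
  using mem_range_initial_cong[OF assms] by blast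

text \<open>The increasing functions violating one of the last two conclusions are covered by the
  countably many nowhere dense sets \<open>A N\<close> and \<open>B N\<close>, so a nonmeager set
  contains a function outside all of them.\<close>

lemma obtain_strict_mono_large_complement_enum:
  assumes "\<not> meager_in increasing_baire_space {g. strict_mono g \<and> Q g}"
  obtains g where "strict_mono g" "Q g" "infinite (- range g)" "\<not> le_star (enum (- range g)) h"
proof -
  \<comment> \<open>By \<open>enum_le_iff\<close>, when the complement of the range is infinite,
    membership in \<open>A N\<close> says that its enumeration is at most \<open>h\<close> from
    \<open>N\<close> on. Membership in \<open>B N\<close> says that the complement lies below
    \<open>N\<close>.\<close>
  define A where "A N = {g :: nat \<Rightarrow> nat. strict_mono g \<and> (\<forall>n\<ge>N. n < card (- range g \<inter> {..<Suc (h n)}))}" for N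
  define B where "B N = {g :: nat \<Rightarrow> nat. strict_mono g \<and> (\<forall>n\<ge>N. n \<in> range g)}" for N :: nat
  have extend: "strict_mono (\<lambda>i. if i < k then g i else c * i + g k)"
    if "strict_mono g" "c \<ge> 1" for g :: "nat \<Rightarrow> nat" and k c
  proof -
    have "g n < g k" if "n < k" for n
      using \<open>strict_mono g\<close> that by (simp add: strict_mono_less)
    then show ?thesis using that
      by (auto simp: strict_mono_def intro: trans_less_add2)
  qed
  have ndA: "nowhere_dense_in increasing_baire_space (A N)" for N
  proof (rule nowhere_dense_in_increasing)
    fix g :: "nat \<Rightarrow> nat" and k assume g: "strict_mono g"
    \<comment> \<open>Slope 1 leaves no gaps from \<open>k + g k\<close> on, so the complement of
      the range has at most \<open>k + g k\<close> elements, too few for the bound at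
      \<open>?n\<close>. Fixing the first \<open>Suc (h ?n)\<close> values fixes the part of the
      range that is counted there.\<close>
    let ?g = "\<lambda>i. if i < k then g i else 1 * i + g k"
    let ?n = "max N (k + g k)"
    have mono: "strict_mono ?g" using g by (rule extend) simp
    have "n \<in> range ?g" if "n \<ge> k + g k" for n
      using that by (intro image_eqI[of _ _ "n - g k"]) auto
    then have "- range ?g \<inter> {..<Suc (h ?n)} \<subseteq> {..<k + g k}"
      using not_le by auto
    then have "card (- range ?g \<inter> {..<Suc (h ?n)}) \<le> card {..<k + g k}"
      by (intro card_mono) auto
    then have card: "card (- range ?g \<inter> {..<Suc (h ?n)}) \<le> ?n" by simp
    have "u \<notin> A N" if "strict_mono u" "\<forall>i<Suc (h ?n). u i = ?g i" for u
    proof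
      assume "u \<in> A N"
      then have "?n < card (- range u \<inter> {..<Suc (h ?n)})"
        unfolding A_def using max.cobounded1 by blast
      with card show False
        unfolding complement_range_initial_cong[OF mono that] by (meson leD)
    qed
    then show "\<exists>h k'. strict_mono h \<and> (\<forall>i<k. h i = g i) \<and>
        (\<forall>u. strict_mono u \<longrightarrow> (\<forall>i<k'. u i = h i) \<longrightarrow> u \<notin> A N)"
      using mono by (intro exI[of _ ?g] exI[of _ "Suc (h ?n)"]) simp
  qed (auto simp: A_def)
  have ndB: "nowhere_dense_in increasing_baire_space (B N)" for N
  proof (rule nowhere_dense_in_increasing)
    fix g :: "nat \<Rightarrow> nat" and k assume g: "strict_mono g"
    \<comment> \<open>Slope 2 makes the later values differ from \<open>g k\<close> by even numbers,
      and the earlier values lie below \<open>g k\<close>. The number \<open>?n\<close> exceeds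
      \<open>g k\<close> by an odd amount, so it is missed, and it is at least
      \<open>N\<close>.\<close>
    let ?g = "\<lambda>i. if i < k then g i else 2 * i + g k"
    let ?n = "Suc (2 * max N k + g k)"
    have mono: "strict_mono ?g" using g by (rule extend) simp
    have "?g i \<noteq> ?n" for i
    proof (cases "i < k")
      case True
      then have "g i < g k" using g by (simp add: strict_mono_less)
      then show ?thesis using True by simp
    next
      case False
      have "2 * i \<noteq> Suc (2 * max N k)" by presburger
      then show ?thesis using False by simp
    qed
    then have n: "?n \<notin> range ?g" unfolding image_iff by (metis (no_types, lifting))
    have "u \<notin> B N" if u: "strict_mono u" "\<forall>i<Suc ?n. u i = ?g i" for u
    proof
      assume "u \<in> B N"
      then have "?n \<in> range u" unfolding B_def by simp
      with n show False using mem_range_initial_cong[OF mono u lessI] by (simp only:)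
    qed
    then show "\<exists>h k'. strict_mono h \<and> (\<forall>i<k. h i = g i) \<and>
        (\<forall>u. strict_mono u \<longrightarrow> (\<forall>i<k'. u i = h i) \<longrightarrow> u \<notin> B N)"
      using mono by (intro exI[of _ ?g] exI[of _ "Suc ?n"]) simp
  qed (auto simp: B_def)
  \<comment> \<open>Both sequences are interleaved into one, with \<open>A\<close> at even and
    \<open>B\<close> at odd positions.\<close>
  have "nowhere_dense_in increasing_baire_space (if even N then A (N div 2) else B (N div 2))" for N
    using ndA ndB by simp
  then have "\<not> {g. strict_mono g \<and> Q g} \<subseteq> (\<Union>N. if even N then A (N div 2) else B (N div 2))"
    using assms meager_in_subset by blast
  then obtain g where g: "strict_mono g" "Q g"
    and not: "\<And>N. g \<notin> (if even N then A (N div 2) else B (N div 2))" by blast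
  have A: "g \<notin> A N" and B: "g \<notin> B N" for N
    using not[of "2 * N"] not[of "Suc (2 * N)"] by simp_all
  have inf: "infinite (- range g)"
    unfolding infinite_nat_iff_unbounded_le using B g(1) unfolding B_def by blast
  moreover have "\<not> le_star (enum (- range g)) h"
  proof
    assume "le_star (enum (- range g)) h"
    then obtain N where "\<forall>n\<ge>N. enum (- range g) n \<le> h n"
      unfolding le_star_def cofinite_eq_sequentially eventually_sequentially by blast
    then show False
      using A[of N] g(1) inf by (simp add: A_def enum_le_iff)
  qed
  ultimately show thesis using that g by blast
qed

text \<open>
  \<open>card (a \<inter> {..<m}) \<le> n\<close> says that the \<open>n\<close>-th element of \<open>a\<close>, taken to be infinite if there is
  none, is at least \<open>m\<close>. The sets whose \<open>n\<close>-th element is infinite form a compact subset of \<open>X\<close>.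
\<close>

lemma continuous_image_bounded_on_sparse:
  fixes X :: "(nat \<Rightarrow> bool) set" and I :: "'i set"
  assumes I: "finite I" and X: "\<And>x. finite (Collect x) \<Longrightarrow> x \<in> X"
    and \<phi>: "continuous_map (product_topology (\<lambda>_. subtopology sequence_space X) I) baire_space \<phi>"
  shows "\<exists>g. \<forall>x\<in>PiE I (\<lambda>_. X). \<forall>n.
           (\<forall>i\<in>I. card (Collect (x i) \<inter> {..<g n}) \<le> n) \<longrightarrow> \<phi> x n \<le> g n"
proof -
  let ?C = "product_topology (\<lambda>_. sequence_space) I :: ('i \<Rightarrow> nat \<Rightarrow> bool) topology"
  have "\<exists>m. \<forall>x\<in>PiE I (\<lambda>_. X). (\<forall>i\<in>I. card (Collect (x i) \<inter> {..<m}) \<le> n) \<longrightarrow> \<phi> x n \<le> m" for n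
  proof -
    define F where "F m = {x \<in> topspace ?C. \<forall>i\<in>I. card (Collect (x i) \<inter> {..<m}) \<le> n}" for m
    have open_gt: "openin sequence_space {x :: nat \<Rightarrow> bool. n < card (Collect x \<inter> {..<m})}" for m
      unfolding openin_sequence_space
    proof (intro ballI exI[of _ m] allI impI)
      fix x y :: "nat \<Rightarrow> bool"
      assume x: "x \<in> {x. n < card (Collect x \<inter> {..<m})}" and "\<forall>i<m. y i = x i"
      then have "Collect y \<inter> {..<m} = Collect x \<inter> {..<m}" by auto
      then show "y \<in> {x. n < card (Collect x \<inter> {..<m})}" using x by simp
    qed
    have closed: "closedin ?C (F m)" for m
    proof -
      have "topspace ?C - F m = (\<Union>i\<in>I. {x \<in> topspace ?C. x i \<in> {x. n < card (Collect x \<inter> {..<m})}})"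
        by (auto simp: F_def not_le)
      also have "openin ?C \<dots>"
      proof (intro openin_Union ballI, clarify)
        fix i assume "i \<in> I"
        then have "continuous_map ?C sequence_space (\<lambda>x. x i)"
          by (rule continuous_map_product_projection)
        then show "openin ?C {x \<in> topspace ?C. x i \<in> {x. n < card (Collect x \<inter> {..<m})}}"
          using open_gt by (rule openin_continuous_map_preimage)
      qed
      finally show ?thesis by (auto simp: closedin_def F_def)
    qed
    have "decseq F"
    proof (rule antimonoI)
      fix m m' :: nat assume "m \<le> m'"
      then have "card (Collect x \<inter> {..<m}) \<le> card (Collect x \<inter> {..<m'})" for x
        by (intro card_mono) auto
      then show "F m' \<subseteq> F m" unfolding F_def by (auto intro: order_trans)
    qed
    \<comment> \<open>A set with at most \<open>n\<close> elements in every initial segment is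
      finite, so the coordinates of a point in all \<open>F m\<close> lie in
      \<open>X\<close>.\<close>
    moreover have "(\<Inter>m. F m) \<subseteq> PiE I (\<lambda>_. X)"
    proof
      fix x assume x: "x \<in> (\<Inter>m. F m)"
      have "x i \<in> X" if "i \<in> I" for i
      proof (rule X, rule ccontr)
        assume "infinite (Collect (x i))"
        then obtain m where "n < card (Collect (x i) \<inter> {..<m})"
          using infinite_imp_card_initial_gt by blast
        moreover have "x \<in> F m" using x by blast
        ultimately show False using that by (auto simp: F_def)
      qed
      moreover have "x \<in> topspace ?C" using x by (auto simp: F_def)
      ultimately show "x \<in> PiE I (\<lambda>_. X)" by (auto simp: PiE_iff)
    qed
    moreover have "continuous_map (subtopology ?C (PiE I (\<lambda>_. X))) (discrete_topology UNIV) (\<lambda>x. \<phi> x n)"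
      using \<phi> unfolding baire_space_def continuous_map_sequence_space subtopology_product_topology by blast
    moreover have "compact_space ?C"
      by (subst compact_space_product_topology) (use compact_cantor in blast)
    ultimately obtain m where "\<forall>x\<in>topspace ?C \<inter> PiE I (\<lambda>_. X) \<inter> F m. \<phi> x n \<le> m"
      using locally_bounded_near_compact[of ?C F "PiE I (\<lambda>_. X)" "\<lambda>x. \<phi> x n"] closed by blast
    then show ?thesis
      by (intro exI[of _ m]) (auto simp: F_def PiE_iff)
  qed
  then show ?thesis by metis
qed

section \<open>Cantor sets in completely metrizable spaces\<close>

text \<open>Without isolated points, every closed ball contains two disjoint closed balls of at most
  half the radius. A binary sequence selects a branch of such balls, and completeness yields a point
  in all of them. Nearby sequences share long branches, which gives continuity; disjointness at the
  first difference gives injectivity.\<close>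

lemma (in Metric_space) cantor_scheme:
  assumes "mcomplete" "M \<noteq> {}"
    and isolated: "\<And>p r. p \<in> M \<Longrightarrow> r > 0 \<Longrightarrow> \<exists>q\<in>M. q \<noteq> p \<and> d p q < r"
  shows "\<exists>e. continuous_map sequence_space mtopology e \<and> inj (e :: (nat \<Rightarrow> bool) \<Rightarrow> 'a)"
proof -
  define good where "good p r p' r' \<longleftrightarrow> p' \<in> M \<and> 0 < r' \<and> r' \<le> r / 2 \<and> mcball p' r' \<subseteq> mcball p r"
    for p r p' r'
  have "\<exists>q s. good p r p s \<and> good p r q s \<and> mcball p s \<inter> mcball q s = {}"
    if p: "p \<in> M" "r > 0" for p r
  proof -
    obtain q where q: "q \<in> M" "q \<noteq> p" "d p q < r / 2"
      using isolated[of p "r / 2"] p by auto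
    have pos: "d p q > 0" using p q by auto
    \<comment> \<open>With \<open>d p q < r / 2\<close>, the bound \<open>r / 2\<close> keeps both
      balls inside the old one; the bound \<open>d p q / 3\<close> keeps them disjoint.\<close>
    define s where "s = min (r / 2) (d p q / 3)"
    have s: "s > 0" "s \<le> r / 2" "2 * s < d p q"
      using pos p by (auto simp: s_def min_def)
    have "mcball p s \<subseteq> mcball p r" using s p by (auto simp: mcball_def)
    moreover have "mcball q s \<subseteq> mcball p r"
    proof
      fix x assume x: "x \<in> mcball q s"
      then have "d p x \<le> d p q + d q x" using p q by (intro triangle) auto
      then show "x \<in> mcball p r" using x q s p by auto
    qed
    moreover have "mcball p s \<inter> mcball q s = {}"
    proof (rule ccontr)
      assume "mcball p s \<inter> mcball q s \<noteq> {}"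
      then obtain x where x: "x \<in> M" "d p x \<le> s" "d q x \<le> s" by auto
      have "d p q \<le> d p x + d x q" using p q x by (intro triangle) auto
      with x s show False by (simp add: commute)
    qed
    ultimately show ?thesis
      unfolding good_def using p q s by blast
  qed
  then obtain q s where qs: "\<And>p r. p \<in> M \<Longrightarrow> r > 0 \<Longrightarrow> good p r p (s p r)"
      "\<And>p r. p \<in> M \<Longrightarrow> r > 0 \<Longrightarrow> good p r (q p r) (s p r)"
      "\<And>p r. p \<in> M \<Longrightarrow> r > 0 \<Longrightarrow> mcball p (s p r) \<inter> mcball (q p r) (s p r) = {}"
    by metis
  obtain p0 where p0: "p0 \<in> M" using assms(2) by blast
  \<comment> \<open>The value \<open>False\<close> keeps the centre and \<open>True\<close> moves to
    the second centre; both children have the same radius.\<close>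
  define step where "step b pr = (if b then q (fst pr) (snd pr) else fst pr, s (fst pr) (snd pr))" for b pr
  define node where "node x n = rec_nat (p0, 1) (\<lambda>k. step (x k)) n" for x n
  define c where "c x n = fst (node x n)" for x n
  define \<rho> where "\<rho> x n = snd (node x n)" for x n
  define K where "K x n = mcball (c x n) (\<rho> x n)" for x n
  have node_Suc: "node x (Suc n) = step (x n) (node x n)" for x n
    by (simp add: node_def)
  have inv: "c x n \<in> M \<and> \<rho> x n > 0" for x n
  proof (induction n)
    case 0 then show ?case using p0 by (simp add: c_def \<rho>_def node_def)
  next
    case (Suc n)
    then show ?case using qs(1,2)[of "c x n" "\<rho> x n"]
      by (auto simp: c_def \<rho>_def node_Suc step_def good_def)
  qed
  have good: "good (c x n) (\<rho> x n) (c x (Suc n)) (\<rho> x (Suc n))" for x n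
    using qs(1,2)[of "c x n" "\<rho> x n"] inv[of x n] by (auto simp: c_def \<rho>_def node_Suc step_def)
  have Suc_sub: "K x (Suc n) \<subseteq> K x n" for x n
    using good[of x n] by (simp add: good_def K_def)
  then have sub: "K x n \<subseteq> K x m" if "m \<le> n" for x m n
    using that by (rule lift_Suc_antimono_le)
  have small: "\<rho> x n \<le> (1/2) ^ n" for x n
  proof (induction n)
    case 0 then show ?case by (simp add: \<rho>_def node_def)
  next
    case (Suc n)
    then show ?case using good[of x n] by (simp add: good_def)
  qed
  have K: "c x n \<in> K x n" for x n
    using inv[of x n] by (simp add: K_def)
  have close: "d y z \<le> 2 * (1/2) ^ n" if "y \<in> K x n" "z \<in> K x n" for x n y z
  proof -
    have "d y z \<le> d y (c x n) + d (c x n) z"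
      using that inv[of x n] by (intro triangle) (auto simp: K_def)
    then show ?thesis using that small[of x n] by (auto simp: K_def commute)
  qed
  have eps: "\<exists>n. 2 * (1/2) ^ n < \<epsilon>" if "\<epsilon> > 0" for \<epsilon> :: real
    using real_arch_pow_inv[of "\<epsilon> / 2" "1/2"] that by (auto simp: field_simps)
  have "\<exists>l. \<forall>n. l \<in> K x n" for x
  proof -
    have "MCauchy (c x)"
      unfolding MCauchy_def
    proof (intro conjI allI impI)
      show "range (c x) \<subseteq> M" using inv by auto
      fix \<epsilon> :: real assume "\<epsilon> > 0"
      then obtain N where N: "2 * (1/2) ^ N < \<epsilon>" using eps by blast
      have "d (c x n) (c x m) < \<epsilon>" if "N \<le> n" "N \<le> m" for n m
        using close[of "c x n" x N "c x m"] K sub that N by (meson le_less_trans subsetD)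
      then show "\<exists>N. \<forall>n n'. N \<le> n \<longrightarrow> N \<le> n' \<longrightarrow> d (c x n) (c x n') < \<epsilon>" by blast
    qed
    then obtain l where l: "limitin mtopology (c x) l sequentially"
      using assms(1) by (auto simp: mcomplete_def)
    have "l \<in> K x n" for n
    proof (rule limitin_closedin[OF l])
      show "closedin mtopology (K x n)" by (simp add: K_def)
      show "\<forall>\<^sub>F m in sequentially. c x m \<in> K x n"
        unfolding eventually_sequentially using K sub by blast
    qed auto
    then show ?thesis by blast
  qed
  then obtain e where e: "\<And>x n. e x \<in> K x n" by metis
  have node_cong: "node x n = node y n" if "\<forall>i<n. x i = y i" for x y n
    using that by (induction n) (auto simp: node_Suc, simp add: node_def)
  have "continuous_map sequence_space mtopology e"
    unfolding continuous_map_to_metric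
  proof (intro ballI allI impI)
    fix x \<epsilon> assume "\<epsilon> > (0 :: real)"
    then obtain n where n: "2 * (1/2) ^ n < \<epsilon>" using eps by blast
    have "e y \<in> mball (e x) \<epsilon>" if "\<forall>i<n. y i = x i" for y
    proof -
      have "K y n = K x n"
        using node_cong[OF that] by (simp add: K_def c_def \<rho>_def)
      then have "d (e x) (e y) \<le> 2 * (1/2) ^ n" using e close by metis
      moreover have "e x \<in> M" "e y \<in> M" using e[of _ 0] by (auto simp: K_def)
      ultimately show ?thesis using n by simp
    qed
    then show "\<exists>U. openin sequence_space U \<and> x \<in> U \<and> (\<forall>y\<in>U. e y \<in> mball (e x) \<epsilon>)"
      using openin_cylinder[of n x] by (intro exI[of _ "{y. \<forall>i<n. y i = x i}"]) simp
  qed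
  moreover have "inj e"
  proof (rule injI, rule ccontr)
    fix x y assume eq: "e x = e y" and "x \<noteq> y"
    \<comment> \<open>At the first difference the two branches still share their node, so they
      continue into its two disjoint children.\<close>
    define n where "n = (LEAST n. x n \<noteq> y n)"
    have n: "x n \<noteq> y n" unfolding n_def by (rule LeastI_ex) (use \<open>x \<noteq> y\<close> in auto)
    have less: "x i = y i" if "i < n" for i
      using not_less_Least[of i "\<lambda>n. x n \<noteq> y n"] that by (simp add: n_def)
    have same: "node x n = node y n" by (rule node_cong) (simp add: less)
    have "K x (Suc n) \<inter> K y (Suc n) = {}"
      using n same qs(3)[of "c x n" "\<rho> x n"] inv[of x n]
      by (cases "x n"; cases "y n") (auto simp: K_def c_def \<rho>_def node_Suc step_def simp del: mcball_def in_mcball)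
    then show False using e[of x "Suc n"] e[of y "Suc n"] eq by auto
  qed
  ultimately show ?thesis by blast
qed

text \<open>An isolated point would be a compact neighbourhood of itself, so
  \<open>cantor_scheme\<close> applies. A continuous injection of a compact space into a Hausdorff
  space is an embedding.\<close>

lemma cantor_embedding:
  assumes "completely_metrizable_space P" "topspace P \<noteq> {}" "nowhere_locally_compact P"
  obtains e :: "(nat \<Rightarrow> bool) \<Rightarrow> 'a" where "embedding_map sequence_space P e"
proof -
  obtain M d where M: "Metric_space M d" "Metric_space.mcomplete M d" "P = Metric_space.mtopology M d"
    using assms(1) unfolding completely_metrizable_space_def by blast
  interpret Metric_space M d by fact
  have "\<exists>q\<in>M. q \<noteq> p \<and> d p q < r" if p: "p \<in> M" "r > 0" for p r
  proof (rule ccontr)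
    assume "\<not> ?thesis"
    then have "mball p r \<subseteq> {p}" by auto
    moreover have "openin P (mball p r)" "compactin P {p}" "p \<in> mball p r" "p \<in> topspace P"
      using p M(3) by auto
    ultimately show False
      using assms(3) unfolding nowhere_locally_compact_def by blast
  qed
  moreover have "M \<noteq> {}" using assms(2) M(3) by simp
  ultimately obtain e :: "(nat \<Rightarrow> bool) \<Rightarrow> 'a" where e: "continuous_map sequence_space P e" "inj e"
    using cantor_scheme[OF M(2)] unfolding M(3) by blast
  moreover have "Hausdorff_space P" using M(3) Hausdorff_space_mtopology by simp
  ultimately have "embedding_map sequence_space P e"
    using compact_cantor by (intro continuous_imp_embedding_map) (auto intro: inj_on_subset)
  then show thesis by (rule that)
qed

section \<open>Bounded and dominating families\<close>

lemma le_star_iff: "le_star f g \<longleftrightarrow> (\<exists>N. \<forall>n\<ge>N. f n \<le> g n)"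
  unfolding le_star_def cofinite_eq_sequentially eventually_sequentially ..

lemma le_star_trans: "le_star f g \<Longrightarrow> le_star g h \<Longrightarrow> le_star f h"
  unfolding le_star_iff by (meson le_trans max.bounded_iff)

lemma le_imp_le_star: "(\<And>n. f n \<le> g n) \<Longrightarrow> le_star f g"
  unfolding le_star_iff by blast

lemma le_sf_eventually_mono:
  assumes "semifilter \<S>" "le_sf \<S> f g" "\<forall>\<^sub>F n in cofinite. f n \<le> g n \<longrightarrow> f' n \<le> g' n"
  shows "le_sf \<S> f' g'"
proof -
  have "{n. f n \<le> g n} - {n. f' n \<le> g' n} \<subseteq> {n. \<not> (f n \<le> g n \<longrightarrow> f' n \<le> g' n)}" by auto
  then have "almost_subset {n. f n \<le> g n} {n. f' n \<le> g' n}"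
    using assms(3) unfolding almost_subset_def eventually_cofinite by (rule finite_subset)
  then show ?thesis using assms(1,2) unfolding semifilter_def le_sf_def by blast
qed

lemma le_star_imp_le_sf:
  assumes "semifilter \<S>" "le_star f g"
  shows "le_sf \<S> f g"
proof -
  obtain A where "A \<in> \<S>" using assms(1) by (auto simp: semifilter_def)
  moreover have "almost_subset A {n. f n \<le> g n}"
    using assms(2) unfolding almost_subset_def le_star_def eventually_cofinite
    by (rule finite_subset[rotated]) auto
  ultimately show ?thesis using assms(1) unfolding semifilter_def le_sf_def by blast
qed

lemma le_sf_infinite: "semifilter \<S> \<Longrightarrow> le_sf \<S> f g \<Longrightarrow> infinite {n. f n \<le> g n}"
  by (auto simp: semifilter_def le_sf_def)

lemma sequence_bounded:
  fixes y :: "nat \<Rightarrow> nat \<Rightarrow> nat"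
  shows "\<exists>h. \<forall>i. le_star (y i) h"
proof (intro exI allI)
  fix i
  have "y i n \<le> (\<Sum>j\<le>n. y j n)" if "n \<ge> i" for n
    using that by (intro member_le_sum) auto
  then show "le_star (y i) (\<lambda>n. \<Sum>j\<le>n. y j n)" unfolding le_star_iff by blast
qed

lemma dominating_infinite:
  assumes "dominating D"
  shows "infinite D"
proof
  assume "finite D"
  obtain f where f: "f \<in> D" "le_star (\<lambda>n. Suc (\<Sum>f\<in>D. f n)) f"
    using assms unfolding dominating_def by blast
  then obtain n where "Suc (\<Sum>f\<in>D. f n) \<le> f n" unfolding le_star_iff by blast
  moreover have "f n \<le> (\<Sum>f\<in>D. f n)" using f(1) \<open>finite D\<close> by (intro member_le_sum) auto
  ultimately show False by simp
qed

text \<open>Induction on the size of the subsets replaces the count of finite subsets of \<open>A\<close>.\<close>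

lemma finite_subset_family_bounded:
  fixes w :: "'b set \<Rightarrow> nat \<Rightarrow> nat"
  assumes bdd: "\<And>v :: 'b \<Rightarrow> nat \<Rightarrow> nat. bounded_wrt le_star (v ` A)"
  shows "\<exists>y. \<forall>F. finite F \<longrightarrow> F \<subseteq> A \<longrightarrow> le_star (w F) y"
proof -
  have "\<exists>y. \<forall>F. finite F \<longrightarrow> F \<subseteq> A \<longrightarrow> card F = k \<longrightarrow> le_star (w F) y" for k and w :: "'b set \<Rightarrow> nat \<Rightarrow> nat"
  proof (induction k arbitrary: w)
    case 0
    have "le_star (w {}) (w {})" by (rule le_imp_le_star) simp
    moreover have "F = {}" if "finite F" "card F = 0" for F :: "'b set"
      using that by simp
    ultimately have "le_star (w F) (w {})" if "finite F" "card F = 0" for F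
      using that by metis
    then show ?case by blast
  next
    case (Suc k)
    \<comment> \<open>One element \<open>a\<close> is split off, and the induction hypothesis is
      used for the shifted family; this is why \<open>w\<close> varies in the induction. The
      resulting bounds \<open>y a\<close> are indexed by single elements of \<open>A\<close>, so
      \<open>bdd\<close> merges them.\<close>
    have "\<forall>a. \<exists>y. \<forall>F. finite F \<longrightarrow> F \<subseteq> A \<longrightarrow> card F = k \<longrightarrow> le_star (w (insert a F)) y"
    proof
      fix a
      show "\<exists>y. \<forall>F. finite F \<longrightarrow> F \<subseteq> A \<longrightarrow> card F = k \<longrightarrow> le_star (w (insert a F)) y"
        by (rule Suc.IH[of "\<lambda>F. w (insert a F)"])
    qed
    from choice[OF this] obtain y where y: "\<And>a F. finite F \<Longrightarrow> F \<subseteq> A \<Longrightarrow> card F = k \<Longrightarrow> le_star (w (insert a F)) (y a)"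
      by blast
    obtain h where h: "\<And>a. a \<in> A \<Longrightarrow> le_star (y a) h"
      using bdd[of y] by (auto simp: bounded_wrt_def)
    have "le_star (w F) h" if F: "finite F" "F \<subseteq> A" "card F = Suc k" for F
    proof -
      obtain a where a: "a \<in> F" using F(3) by fastforce
      have "le_star (w (insert a (F - {a}))) (y a)"
        by (rule y) (use F a in auto)
      then have "le_star (w F) (y a)" using a by (simp add: insert_absorb)
      moreover have "le_star (y a) h" using h a F(2) by blast
      ultimately show ?thesis by (rule le_star_trans)
    qed
    then show ?case by blast
  qed
  then have "\<forall>k. \<exists>y. \<forall>F. finite F \<longrightarrow> F \<subseteq> A \<longrightarrow> card F = k \<longrightarrow> le_star (w F) y" by blast
  from choice[OF this] obtain y
    where y: "\<And>k F. finite F \<Longrightarrow> F \<subseteq> A \<Longrightarrow> card F = k \<Longrightarrow> le_star (w F) (y k)"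
    by blast
  \<comment> \<open>Only the countably many bounds for the different sizes remain to be
    merged.\<close>
  obtain h where h: "\<And>k. le_star (y k) h" using sequence_bounded by blast
  show ?thesis
    by (intro exI[of _ h] allI impI le_star_trans[OF y[OF _ _ refl] h])
qed

lemma finite_card_ordLess:
  assumes "finite A" "infinite B"
  shows "|A| <o |B|"
  using finite_ordLess_infinite[OF card_of_Well_order card_of_Well_order, of A B] assms
  unfolding Field_card_of by blast

lemma card_PiE_ordLeq:
  assumes "infinite A" "finite I"
  shows "|PiE I (\<lambda>_. A)| \<le>o |A|"
  using assms(2)
proof induction
  case empty
  have "A \<noteq> {}" using assms(1) by auto
  then show ?case by (simp add: card_of_singl_ordLeq)
next
  case (insert i I)
  have "PiE (insert i I) (\<lambda>_. A) \<subseteq> (\<lambda>(a, x). x(i := a)) ` (A \<times> PiE I (\<lambda>_. A))"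
    by (simp add: PiE_insert_eq)
  then have "|PiE (insert i I) (\<lambda>_. A)| \<le>o |A \<times> PiE I (\<lambda>_. A)|"
    by (rule surj_imp_ordLeq)
  also have "|A \<times> PiE I (\<lambda>_. A)| \<le>o |A \<times> A|"
    by (rule card_of_Times_mono2[OF insert.IH])
  also have "|A \<times> A| =o |A|"
    using assms(1) by (rule card_of_Times_same_infinite)
  finally show ?case .
qed

section \<open>A scale of increasing functions\<close>

text \<open>The cardinal \<open>|D|\<close> is a well-order of \<open>D\<close> whose proper initial
  segments are smaller than \<open>D\<close>, so \<open>D\<close> can index its own scale:
  \<open>z a\<close> bounds the predecessors of \<open>a\<close>, and \<open>f a\<close> is found by
  recursion along this order. Indices outside \<open>D\<close> have no predecessors and cause no
  exception.\<close>

lemma exists_scale: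
  assumes S: "semifilter \<S>" and D: "dominating D"
    and small: "\<And>Y :: (nat \<Rightarrow> nat) set. |Y| <o |D| \<Longrightarrow> bounded_wrt le_star Y"
    and nonmeager: "\<And>y. \<not> meager_in increasing_baire_space {g. strict_mono g \<and> le_sf \<S> y g}"
  obtains z f :: "(nat \<Rightarrow> nat) \<Rightarrow> nat \<Rightarrow> nat"
  where "\<And>a. strict_mono (f a)" "\<And>a. infinite (- range (f a))"
    "\<And>a. \<not> le_star (enum (- range (f a))) a" "\<And>a. le_sf \<S> (z a) (f a)"
    "\<And>g. |{a \<in> D. \<not> le_star g (z a)}| <o |D|"
    "\<And>F. finite F \<Longrightarrow> F \<subseteq> D \<Longrightarrow> infinite {n. \<forall>a\<in>F. z a n \<le> f a n}"
proof -
  let ?r = "|D|"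
  have wo: "well_order_on D ?r" by (rule card_of_well_order_on)
  have field: "Field ?r = D" by (rule Field_card_of)
  have inf: "infinite D" using D by (rule dominating_infinite)
  have lin: "refl_on D ?r" "trans ?r" "total_on D ?r"
    using wo unfolding order_on_defs by blast+
  have under: "|underS ?r a| <o ?r" for a
  proof (cases "a \<in> D")
    case True
    then have "a \<in> Field ?r" unfolding field .
    then show ?thesis by (rule card_of_underS[OF card_of_Card_order])
  next
    case False
    then have "underS ?r a = {}" using field by (auto simp: underS_def Field_def)
    then show ?thesis using finite_card_ordLess[OF finite.emptyI inf] by simp
  qed
  have "\<exists>z. \<forall>b\<in>underS ?r a. le_star b z" for a
    using small[OF under[of a]] unfolding bounded_wrt_def by blast
  then obtain z where z: "\<And>a b. b \<in> underS ?r a \<Longrightarrow> le_star b (z a)" by metis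
  have cofinal: "|{a \<in> D. \<not> le_star g (z a)}| <o ?r" for g
  proof -
    obtain b where b: "b \<in> D" "le_star g b" using D unfolding dominating_def by blast
    \<comment> \<open>If \<open>z a\<close> does not bound \<open>g\<close>, it does not bound
      \<open>b\<close> either, so \<open>b\<close> is not strictly before \<open>a\<close>.\<close>
    have "{a \<in> D. \<not> le_star g (z a)} \<subseteq> underS ?r b \<union> {b}"
    proof
      fix a assume a: "a \<in> {a \<in> D. \<not> le_star g (z a)}"
      then have "\<not> le_star b (z a)" using le_star_trans[OF b(2), of "z a"] by blast
      then have "b \<notin> underS ?r a" using z by blast
      then show "a \<in> underS ?r b \<union> {b}"
        using a b(1) lin(3) unfolding total_on_def underS_def by blast
    qed
    moreover have "|underS ?r b \<union> {b}| <o ?r"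
      by (rule card_of_Un_ordLess_infinite_Field[OF _ card_of_Card_order under finite_card_ordLess])
        (use inf in \<open>simp_all add: field\<close>)
    ultimately show ?thesis using ordLeq_ordLess_trans[OF card_of_mono1] by blast
  qed
  define B where "B f F = {n. \<forall>b\<in>F. z b n \<le> f b n}" for f :: "(nat \<Rightarrow> nat) \<Rightarrow> nat \<Rightarrow> nat" and F
  \<comment> \<open>The requirement on a candidate \<open>g\<close> for \<open>f a\<close>. It
    refers to \<open>f\<close> at predecessors of \<open>a\<close> only, as the recursion
    demands.\<close>
  define P where "P f a g \<longleftrightarrow> strict_mono g \<and> infinite (- range g) \<and> \<not> le_star (enum (- range g)) a \<and>
     le_sf \<S> (z a) g \<and>
     (\<forall>F. finite F \<longrightarrow> F \<subseteq> underS ?r a \<longrightarrow> infinite ({n. z a n \<le> g n} \<inter> B f F))"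
    for f a and g :: "nat \<Rightarrow> nat"
  have inf_B: "infinite (B f F)" if F: "finite F" "F \<subseteq> D" and P: "\<And>b. b \<in> F \<Longrightarrow> P f b (f b)" for f F
  proof (cases "F = {}")
    case True
    then show ?thesis by (simp add: B_def)
  next
    case False
    \<comment> \<open>For the last index \<open>m\<close> of \<open>F\<close>, all other members are
      predecessors, so the requirement at stage \<open>m\<close> covers the whole of
      \<open>F\<close>.\<close>
    have "\<exists>m\<in>F. \<forall>b\<in>F. (b, m) \<in> ?r"
      using F(1) False F(2)
    proof (induction rule: finite_ne_induct)
      case (singleton x)
      then show ?case using lin(1) by (auto simp: refl_on_def)
    next
      case (insert x F)
      then obtain m where m: "m \<in> F" "\<forall>b\<in>F. (b, m) \<in> ?r" by auto
      have mx: "m \<in> D" "x \<in> D" "m \<noteq> x" using insert m by auto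
      then consider "(x, m) \<in> ?r" | "(m, x) \<in> ?r" using lin(3) unfolding total_on_def by blast
      then show ?case
      proof cases
        case 1
        then show ?thesis using m by blast
      next
        case 2
        then have "\<forall>b\<in>F. (b, x) \<in> ?r" using m(2) lin(2) unfolding trans_def by blast
        moreover have "(x, x) \<in> ?r" using lin(1) mx(2) by (auto simp: refl_on_def)
        ultimately show ?thesis by blast
      qed
    qed
    then obtain m where m: "m \<in> F" "\<forall>b\<in>F. (b, m) \<in> ?r" by blast
    have "infinite ({n. z m n \<le> f m n} \<inter> B f (F - {m}))"
          proof -
      have "finite (F - {m})" "F - {m} \<subseteq> underS ?r m" using F(1) m by (auto simp: underS_def)
      then show ?thesis using P[OF m(1)] unfolding P_def by blast
    qed
    also have "{n. z m n \<le> f m n} \<inter> B f (F - {m}) = B f F"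
      using m(1) by (auto simp: B_def)
    finally show ?thesis .
  qed
  have "\<exists>f. \<forall>a. P f a (f a)"
  proof (rule dependent_wf_choice)
    show "wf (?r - Id)" using wo by (simp add: well_order_on_def)
  next
    fix f g :: "(nat \<Rightarrow> nat) \<Rightarrow> nat \<Rightarrow> nat" and a u
    assume eq: "\<And>b. (b, a) \<in> ?r - Id \<Longrightarrow> f b = g b"
    have "B f F = B g F" if "F \<subseteq> underS ?r a" for F
    proof -
      have "f b = g b" if "b \<in> F" for b
        by (rule eq) (use that \<open>F \<subseteq> underS ?r a\<close> in \<open>auto simp: underS_def\<close>)
      then show ?thesis by (simp add: B_def)
    qed
    then show "P f a u = P g a u" unfolding P_def by (simp cong: conj_cong imp_cong)
  next
    fix a and f :: "(nat \<Rightarrow> nat) \<Rightarrow> nat \<Rightarrow> nat"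
    assume IH: "\<And>b. (b, a) \<in> ?r - Id \<Longrightarrow> P f b (f b)"
    let ?A = "underS ?r a"
    have AD: "?A \<subseteq> D" using field by (auto simp: underS_def Field_def)
    define nxt where "nxt F n = (LEAST m. m \<in> B f F \<and> n \<le> m)" for F n
    have nxt: "nxt F n \<in> B f F \<and> n \<le> nxt F n" if "finite F" "F \<subseteq> ?A" for F n
    proof -
      have "infinite (B f F)"
        by (rule inf_B) (use that AD IH in \<open>auto simp: underS_def\<close>)
      then have "\<exists>m. m \<in> B f F \<and> n \<le> m" unfolding infinite_nat_iff_unbounded_le by blast
      then show ?thesis unfolding nxt_def by (rule LeastI_ex)
    qed
    \<comment> \<open>There are fewer than \<open>|D|\<close> predecessors, so a single
      \<open>y\<close> eventually bounds \<open>z a (nxt F n)\<close> for every finite set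
      \<open>F\<close> of them.\<close>
    have "bounded_wrt le_star (v ` ?A)" for v :: "(nat \<Rightarrow> nat) \<Rightarrow> nat \<Rightarrow> nat"
      by (rule small[OF ordLeq_ordLess_trans[OF card_of_image under]])
    from finite_subset_family_bounded[OF this, of "\<lambda>F n. z a (nxt F n)"]
    obtain y where y: "\<And>F. finite F \<Longrightarrow> F \<subseteq> ?A \<Longrightarrow> le_star (\<lambda>n. z a (nxt F n)) y"
      by blast
    \<comment> \<open>In the sum, \<open>y\<close> serves the finite intersections and
      \<open>z a\<close> serves the relation between \<open>z a\<close> and
      \<open>f a\<close>.\<close>
    obtain g where g: "strict_mono g" "le_sf \<S> (\<lambda>n. y n + z a n) g" "infinite (- range g)"
        "\<not> le_star (enum (- range g)) a"
      using obtain_strict_mono_large_complement_enum[OF nonmeager] by blast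
    have "infinite ({n. z a n \<le> g n} \<inter> B f F)" if F: "finite F" "F \<subseteq> ?A" for F
      unfolding infinite_nat_iff_unbounded_le
    proof
      fix m
      obtain N where N: "\<And>n. n \<ge> N \<Longrightarrow> z a (nxt F n) \<le> y n"
        using y[OF F] unfolding le_star_iff by blast
      obtain n where n: "n \<ge> max m N" "y n + z a n \<le> g n"
        using le_sf_infinite[OF S g(2)] unfolding infinite_nat_iff_unbounded_le by blast
      \<comment> \<open>The inequality at \<open>n\<close> is carried by monotonicity of
        \<open>g\<close> to the next element of \<open>B f F\<close>, where it is wanted.\<close>
      have "z a (nxt F n) \<le> g n" using N[of n] n by simp
      also have "g n \<le> g (nxt F n)" using nxt[OF F] g(1) by (simp add: strict_mono_less_eq)
      finally show "\<exists>n\<ge>m. n \<in> {n. z a n \<le> g n} \<inter> B f F"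
        using nxt[OF F, of n] n(1) by (intro exI[of _ "nxt F n"]) auto
    qed
    moreover have "le_sf \<S> (z a) g"
      by (rule le_sf_eventually_mono[OF S g(2)]) (rule always_eventually, auto)
    ultimately show "\<exists>g. P f a g" unfolding P_def using g by blast
  qed
  then obtain f where f: "\<And>a. P f a (f a)" by blast
  show thesis
  proof (rule that[of f z])
    show "infinite {n. \<forall>a\<in>F. z a n \<le> f a n}" if "finite F" "F \<subseteq> D" for F
      using inf_B[OF that f] by (simp add: B_def)
  qed (use f cofinal in \<open>simp_all add: P_def\<close>)
qed

section \<open>Sets concentrated on the finite sets\<close>

text \<open>Compactness gives a function \<open>g\<close>, and the indices in \<open>R\<close>,
  whose \<open>z a\<close> does not bound \<open>g\<close>, are few. A point with a coordinate from
  \<open>R\<close> lies in a slice with one coordinate fewer, to which the induction hypothesis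
  applies. For any other point, \<open>fip\<close> gives infinitely many places where all infinite
  coordinates are sparse enough for \<open>g\<close> to bound the image.\<close>

lemma concentrated_powers_not_dominating:
  fixes f z :: "(nat \<Rightarrow> nat) \<Rightarrow> nat \<Rightarrow> nat" and I :: "'i set"
  assumes small: "\<And>Y :: (nat \<Rightarrow> nat) set. |Y| <o |D| \<Longrightarrow> bounded_wrt le_star Y"
    and mono: "\<And>a. strict_mono (f a)"
    and cofinal: "\<And>g. |{a \<in> D. \<not> le_star g (z a)}| <o |D|"
    and fip: "\<And>F. finite F \<Longrightarrow> F \<subseteq> D \<Longrightarrow> infinite {n. \<forall>a\<in>F. z a n \<le> f a n}"
    and X: "X = {x. finite (Collect x)} \<union> (\<lambda>a i. i \<in> range (f a)) ` D"
    and "finite I"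
    and "continuous_map (product_topology (\<lambda>_. subtopology sequence_space X) I) baire_space \<phi>"
  shows "\<not> dominating (\<phi> ` PiE I (\<lambda>_. X))"
  using assms(6,7)
proof (induction arbitrary: \<phi> rule: finite_psubset_induct)
  case (psubset I)
  let ?top = "\<lambda>I :: 'i set. product_topology (\<lambda>_. subtopology sequence_space X) I"
  define ind where "ind a = (\<lambda>i. i \<in> range (f a))" for a
  have "x \<in> X" if "finite (Collect x)" for x using that unfolding X by blast
  from continuous_image_bounded_on_sparse[OF psubset.hyps(1) this psubset.prems]
  obtain g where g: "\<And>x n. x \<in> PiE I (\<lambda>_. X) \<Longrightarrow>
      (\<And>i. i \<in> I \<Longrightarrow> card (Collect (x i) \<inter> {..<g n}) \<le> n) \<Longrightarrow> \<phi> x n \<le> g n"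
    by blast
  define R where "R = {a \<in> D. \<not> le_star g (z a)}"
  \<comment> \<open>Freezing coordinate \<open>i\<close> at \<open>ind a\<close> turns the image of
    this slice into a continuous image of a smaller power.\<close>
  have "\<exists>h. \<forall>y\<in>PiE (I - {i}) (\<lambda>_. X). \<not> le_star h (\<phi> (y(i := ind a)))"
    if i: "i \<in> I" and a: "a \<in> R" for i a
  proof -
    have ind: "ind a \<in> X" using a X by (auto simp: R_def ind_def)
    have "continuous_map (?top (I - {i})) (?top I) (\<lambda>y. y(i := ind a))"
      unfolding continuous_map_componentwise
    proof (intro conjI ballI)
      show "(\<lambda>y. y(i := ind a)) ` topspace (?top (I - {i})) \<subseteq> extensional I"
        using i by (auto simp: PiE_iff extensional_def)
      fix k assume k: "k \<in> I"
      show "continuous_map (?top (I - {i})) (subtopology sequence_space X) (\<lambda>y. (y(i := ind a)) k)"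
      proof (cases "k = i")
        case True
        then show ?thesis using ind by simp
      next
        case False
        with k have "k \<in> I - {i}" by blast
        from continuous_map_product_projection[OF this, of "\<lambda>_. subtopology sequence_space X"]
        show ?thesis using False by simp
      qed
    qed
    then have "continuous_map (?top (I - {i})) baire_space (\<phi> \<circ> (\<lambda>y. y(i := ind a)))"
      using psubset.prems by (rule continuous_map_compose)
    moreover have "I - {i} \<subset> I" using i by blast
    ultimately have "\<not> dominating ((\<phi> \<circ> (\<lambda>y. y(i := ind a))) ` PiE (I - {i}) (\<lambda>_. X))"
      using psubset.IH by blast
    then show ?thesis unfolding dominating_def by auto
  qed
  then obtain h where h: "\<And>i a y. i \<in> I \<Longrightarrow> a \<in> R \<Longrightarrow> y \<in> PiE (I - {i}) (\<lambda>_. X) \<Longrightarrow>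
      \<not> le_star (h i a) (\<phi> (y(i := ind a)))"
    by metis
  have "bounded_wrt le_star (h i ` R)" for i
    by (rule small[OF ordLeq_ordLess_trans[OF card_of_image]]) (use cofinal in \<open>simp add: R_def\<close>)
  then have "\<exists>H. \<forall>a\<in>R. le_star (h i a) H" for i
    unfolding bounded_wrt_def by blast
  then obtain H where H: "\<And>i a. a \<in> R \<Longrightarrow> le_star (h i a) (H i)" by metis
  \<comment> \<open>The sum exceeds every bound for the slices, and the successor makes it strictly
    larger than \<open>g\<close>; so no point of the power can have an image eventually above
    \<open>w\<close>.\<close>
  define w where "w n = Suc (g n) + (\<Sum>i\<in>I. H i n)" for n
  show ?case
  proof
    assume "dominating (\<phi> ` PiE I (\<lambda>_. X))"
    then obtain x where x: "x \<in> PiE I (\<lambda>_. X)" and dom: "le_star w (\<phi> x)"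
      unfolding dominating_def by blast
    show False
    proof (cases "\<exists>i\<in>I. x i \<in> ind ` R")
      case True
      then obtain i a where i: "i \<in> I" and a: "a \<in> R" and xi: "x i = ind a" by blast
      have "H i n \<le> w n" for n
        using member_le_sum[of i I "\<lambda>i. H i n"] i psubset.hyps(1) by (simp add: w_def)
      then have "le_star (H i) w" by (rule le_imp_le_star)
      then have "le_star (h i a) (\<phi> x)"
        using H[OF a] dom le_star_trans by blast
      moreover have "x(i := undefined) \<in> PiE (I - {i}) (\<lambda>_. X)"
        using x by (auto simp: PiE_iff extensional_def)
      moreover have "(x(i := undefined))(i := ind a) = x" using xi by auto
      ultimately show False using h[OF i a] by metis
    next
      case False
      \<comment> \<open>Infinite coordinates come from indices outside \<open>R\<close>; a finite
        coordinate meets the cardinality bound as soon as \<open>n\<close> reaches its size.\<close>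
      define J where "J = {i \<in> I. infinite (Collect (x i))}"
      have "\<exists>a\<in>D. a \<notin> R \<and> x i = ind a" if "i \<in> J" for i
        using that False x X unfolding J_def by (force simp: PiE_iff ind_def)
      then obtain c where c: "\<And>i. i \<in> J \<Longrightarrow> c i \<in> D \<and> c i \<notin> R \<and> x i = ind (c i)" by metis
      have "\<exists>N. \<forall>n\<ge>N. if i \<in> J then g n \<le> z (c i) n else card (Collect (x i)) \<le> n"
        if "i \<in> I" for i
        using c[of i] unfolding R_def le_star_iff by (cases "i \<in> J") auto
      then have "\<forall>\<^sub>F n in sequentially. \<forall>i\<in>I.
          if i \<in> J then g n \<le> z (c i) n else card (Collect (x i)) \<le> n"
        unfolding eventually_ball_finite_distrib[OF psubset.hyps(1)] eventually_sequentially by blast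
      moreover have "\<forall>\<^sub>F n in sequentially. w n \<le> \<phi> x n"
        using dom unfolding le_star_iff eventually_sequentially .
      ultimately have ev: "\<forall>\<^sub>F n in sequentially. w n \<le> \<phi> x n \<and> (\<forall>i\<in>I.
          if i \<in> J then g n \<le> z (c i) n else card (Collect (x i)) \<le> n)"
        by eventually_elim blast
      have "infinite {n. \<forall>a\<in>c ` J. z a n \<le> f a n}"
        by (rule fip) (use psubset.hyps(1) c in \<open>auto simp: J_def\<close>)
      then obtain n where n: "\<forall>a\<in>c ` J. z a n \<le> f a n" "w n \<le> \<phi> x n"
          "\<And>i. i \<in> I \<Longrightarrow> if i \<in> J then g n \<le> z (c i) n else card (Collect (x i)) \<le> n"
        using ev unfolding eventually_sequentially infinite_nat_iff_unbounded_le by blast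
      have "\<phi> x n \<le> g n"
      proof (rule g[OF x])
        fix i assume i: "i \<in> I"
        show "card (Collect (x i) \<inter> {..<g n}) \<le> n"
        proof (cases "i \<in> J")
          case True
          then have "g n \<le> f (c i) n" using n(1) n(3)[OF i] by fastforce
          then have "\<not> n < card (range (f (c i)) \<inter> {..<g n})"
            using card_range_initial_gt_iff[OF mono] by simp
          moreover have "Collect (x i) = range (f (c i))" using c[OF True] by (simp add: ind_def)
          ultimately show ?thesis by simp
        next
          case False
          then have "finite (Collect (x i))" using i by (simp add: J_def)
          then have "card (Collect (x i) \<inter> {..<g n}) \<le> card (Collect (x i))"
            by (intro card_mono) auto
          then show ?thesis using n(3)[OF i] False by simp
        qed
      qed
      then show False using n(2) by (simp add: w_def)
    qed
  qed
qed

text \<open>With a single coordinate, \<open>g\<close> eventually bounds the image of the point with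
  index \<open>a\<close> outside \<open>R\<close> wherever \<open>z a n \<le> f a n\<close>, and
  these places form a member of \<open>\<S>\<close>. The points from \<open>R\<close> are few enough
  for a common \<open>le_star\<close> bound, and at a finite set \<open>g\<close> is itself an
  eventual bound.\<close>

lemma concentrated_bounded:
  fixes f z :: "(nat \<Rightarrow> nat) \<Rightarrow> nat \<Rightarrow> nat"
  assumes S: "semifilter \<S>"
    and small: "\<And>Y :: (nat \<Rightarrow> nat) set. |Y| <o |D| \<Longrightarrow> bounded_wrt le_star Y"
    and mono: "\<And>a. strict_mono (f a)"
    and zf: "\<And>a. le_sf \<S> (z a) (f a)"
    and cofinal: "\<And>g. |{a \<in> D. \<not> le_star g (z a)}| <o |D|"
    and X: "X = {x. finite (Collect x)} \<union> (\<lambda>a i. i \<in> range (f a)) ` D"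
    and \<phi>: "continuous_map (subtopology sequence_space X) baire_space \<phi>"
  shows "bounded_wrt (le_sf \<S>) (\<phi> ` X)"
proof -
  define ind where "ind a = (\<lambda>i. i \<in> range (f a))" for a
  \<comment> \<open>Treating \<open>X\<close> as its power over a one-point index set makes the
    compactness lemma for powers available.\<close>
  have "continuous_map (product_topology (\<lambda>_. subtopology sequence_space X) {()})
      (subtopology sequence_space X) (\<lambda>x. x ())"
    by (rule continuous_map_product_projection) simp
  then have "continuous_map (product_topology (\<lambda>_. subtopology sequence_space X) {()})
      baire_space (\<phi> \<circ> (\<lambda>x. x ()))"
    using \<phi> by (rule continuous_map_compose)
  from continuous_image_bounded_on_sparse[OF _ _ this] X
  obtain g where g': "\<And>x n. x \<in> PiE {()} (\<lambda>_. X) \<Longrightarrow>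
      card (Collect (x ()) \<inter> {..<g n}) \<le> n \<Longrightarrow> (\<phi> \<circ> (\<lambda>x. x ())) x n \<le> g n"
    by auto
  have g: "\<phi> x n \<le> g n" if "x \<in> X" "card (Collect x \<inter> {..<g n}) \<le> n" for x n
    using g'[of "\<lambda>_. x" n] that by (auto simp: PiE_iff extensional_def)
  define R where "R = {a \<in> D. \<not> le_star g (z a)}"
  have "bounded_wrt le_star ((\<lambda>a. \<phi> (ind a)) ` R)"
    by (rule small[OF ordLeq_ordLess_trans[OF card_of_image]]) (use cofinal in \<open>simp add: R_def\<close>)
  then obtain H where H: "\<And>a. a \<in> R \<Longrightarrow> le_star (\<phi> (ind a)) H"
    unfolding bounded_wrt_def by blast
  define w where "w n = g n + H n" for n
  have "le_sf \<S> (\<phi> x) w" if x: "x \<in> X" for x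
  proof -
    consider "finite (Collect x)" | a where "a \<in> R" "x = ind a" | a where "a \<in> D - R" "x = ind a"
      using x X by (auto simp: ind_def)
    then show ?thesis
    proof cases
      case 1
      have "\<phi> x n \<le> w n" if "n \<ge> card (Collect x)" for n
      proof -
        have "card (Collect x \<inter> {..<g n}) \<le> card (Collect x)"
          using 1 by (intro card_mono) auto
        then show ?thesis using g[OF x, of n] that by (simp add: w_def)
      qed
      then have "le_star (\<phi> x) w" unfolding le_star_iff by blast
      with S show ?thesis by (rule le_star_imp_le_sf)
    next
      case 2
      have "le_star H w" by (rule le_imp_le_star) (simp add: w_def)
      with H[OF 2(1)] have "le_star (\<phi> x) w" unfolding 2(2) by (rule le_star_trans)
      with S show ?thesis by (rule le_star_imp_le_sf)
    next
      case 3
      have "le_star g (z a)" using 3(1) by (simp add: R_def)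
      then have "\<forall>\<^sub>F n in cofinite. z a n \<le> f a n \<longrightarrow> \<phi> x n \<le> w n"
        unfolding le_star_def
      proof eventually_elim
        case (elim n)
        show ?case
        proof
          assume "z a n \<le> f a n"
          then have "\<not> n < card (range (f a) \<inter> {..<g n})"
            using elim card_range_initial_gt_iff[OF mono, of n a "g n"] by simp
          then have "\<phi> x n \<le> g n" using g[OF x, of n] 3(2) by (simp add: ind_def)
          then show "\<phi> x n \<le> w n" by (simp add: w_def)
        qed
      qed
      with S zf show ?thesis by (rule le_sf_eventually_mono)
    qed
  qed
  then show ?thesis unfolding bounded_wrt_def by blast
qed

section \<open>Witnesses inside the Cantor space, in two cases\<close>

lemma dominating_mono: "A \<subseteq> B \<Longrightarrow> dominating A \<Longrightarrow> dominating B"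
  unfolding dominating_def by blast

text \<open>Collects what has to be carried along an embedding into \<open>P\<close>. The last two
  clauses replace failure of the Hurewicz property by one explicit map: enumeration of the
  complement, continuous because the complements are infinite.\<close>

definition cantor_witness :: "nat set set \<Rightarrow> (nat \<Rightarrow> bool) set \<Rightarrow> bool" where
  "cantor_witness \<S> X \<longleftrightarrow>
     (\<forall>n \<phi>. continuous_map (product_topology (\<lambda>_. subtopology sequence_space X) {..<n::nat}) baire_space \<phi> \<longrightarrow>
        \<not> dominating (\<phi> ` PiE {..<n} (\<lambda>_. X))) \<and>
     (\<forall>\<phi>. continuous_map (subtopology sequence_space X) baire_space \<phi> \<longrightarrow> bounded_wrt (le_sf \<S>) (\<phi> ` X)) \<and>
     (\<forall>x\<in>X. infinite (- Collect x)) \<and>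
     \<not> bounded_wrt le_star ((\<lambda>x. enum (- Collect x)) ` X)"

lemma cantor_witnessD:
  assumes "cantor_witness \<S> X"
  shows cantor_witness_not_dominating: "continuous_map (product_topology (\<lambda>_. subtopology sequence_space X) {..<n::nat}) baire_space \<phi> \<Longrightarrow>
      \<not> dominating (\<phi> ` PiE {..<n} (\<lambda>_. X))"
    and cantor_witness_bounded: "continuous_map (subtopology sequence_space X) baire_space \<psi> \<Longrightarrow>
      bounded_wrt (le_sf \<S>) (\<psi> ` X)"
    and cantor_witness_infinite_complement: "x \<in> X \<Longrightarrow> infinite (- Collect x)"
    and cantor_witness_unbounded: "\<not> bounded_wrt le_star ((\<lambda>x. enum (- Collect x)) ` X)"
  using assms unfolding cantor_witness_def by blast+

lemma cantor_witness_concentrated: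
  assumes S: "semifilter \<S>" and D: "dominating D"
    and small: "\<And>Y :: (nat \<Rightarrow> nat) set. |Y| <o |D| \<Longrightarrow> bounded_wrt le_star Y"
    and nonmeager: "\<And>y. \<not> meager_in increasing_baire_space {g. strict_mono g \<and> le_sf \<S> y g}"
  shows "\<exists>X. cantor_witness \<S> X"
proof -
  obtain z f :: "(nat \<Rightarrow> nat) \<Rightarrow> nat \<Rightarrow> nat"
    where f: "\<And>a. strict_mono (f a)" "\<And>a. infinite (- range (f a))"
      "\<And>a. \<not> le_star (enum (- range (f a))) a" "\<And>a. le_sf \<S> (z a) (f a)"
      and cofinal: "\<And>g. |{a \<in> D. \<not> le_star g (z a)}| <o |D|"
      and fip: "\<And>F. finite F \<Longrightarrow> F \<subseteq> D \<Longrightarrow> infinite {n. \<forall>a\<in>F. z a n \<le> f a n}"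
    by (rule exists_scale[OF S D small nonmeager], assumption) (rule that)
  define X where "X = {x. finite (Collect x)} \<union> (\<lambda>a i. i \<in> range (f a)) ` D"
  have "infinite (- Collect x)" if "x \<in> X" for x
  proof -
    consider "finite (Collect x)" | a where "x = (\<lambda>i. i \<in> range (f a))"
      using \<open>x \<in> X\<close> unfolding X_def by blast
    then show ?thesis
    proof cases
      case 1
      then show ?thesis unfolding finite_compl[OF 1] by simp
    next
      case 2
      then show ?thesis using f(2)[of a] by simp
    qed
  qed
  moreover have "\<not> bounded_wrt le_star ((\<lambda>x. enum (- Collect x)) ` X)"
  proof
    assume "bounded_wrt le_star ((\<lambda>x. enum (- Collect x)) ` X)"
    then obtain h where h: "\<And>x. x \<in> X \<Longrightarrow> le_star (enum (- Collect x)) h"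
      unfolding bounded_wrt_def by blast
    \<comment> \<open>A member of \<open>D\<close> above the supposed bound \<open>h\<close> would
      bound the enumeration belonging to its own index, contrary to the choice of
      \<open>f a\<close>.\<close>
    obtain a where a: "a \<in> D" "le_star h a" using D unfolding dominating_def by blast
    have "(\<lambda>i. i \<in> range (f a)) \<in> X" using a(1) unfolding X_def by blast
    from h[OF this] have "le_star (enum (- range (f a))) h" by simp
    then have "le_star (enum (- range (f a))) a" using a(2) by (rule le_star_trans)
    then show False using f(3)[of a] by contradiction
  qed
  moreover note concentrated_powers_not_dominating[OF small f(1) cofinal fip X_def finite_lessThan]
    concentrated_bounded[OF S small f(1) f(4) cofinal X_def]
  ultimately have "cantor_witness \<S> X"
    unfolding cantor_witness_def by (intro conjI allI impI ballI)
  then show ?thesis ..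
qed

text \<open>Here cardinality alone suffices: \<open>X\<close> and its finite powers have fewer than
  \<open>|D|\<close> points, so their images can be neither dominating nor unbounded for
  \<open>\<S>\<close>.\<close>

lemma cantor_witness_small:
  assumes small: "|Y| <o |D|" and unbounded: "\<not> bounded_wrt le_star Y"
    and D: "\<And>C. dominating C \<Longrightarrow> |D| \<le>o |C|" "infinite D"
    and B: "\<And>C :: (nat \<Rightarrow> nat) set. |C| <o |D| \<Longrightarrow> bounded_wrt (le_sf \<S>) C"
  shows "\<exists>X. cantor_witness \<S> X"
proof -
  \<comment> \<open>A strictly increasing majorant, which therefore enumerates its own range; the
    points of \<open>X\<close> are the complements of these ranges, so that enumerating complements
    returns \<open>inc y\<close>.\<close>
  define inc :: "(nat \<Rightarrow> nat) \<Rightarrow> nat \<Rightarrow> nat" where "inc y n = (\<Sum>i\<le>n. Suc (y i))" for y n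
  have inc: "strict_mono (inc y)" for y
    by (rule strict_monoI_Suc) (simp add: inc_def)
  have le_inc: "le_star y (inc y)" for y
  proof (rule le_imp_le_star)
    fix n
    have "Suc (y n) \<le> (\<Sum>i\<le>n. Suc (y i))" by (rule member_le_sum) auto
    then show "y n \<le> inc y n" by (simp add: inc_def)
  qed
  define X where "X = (\<lambda>y i. i \<notin> range (inc y)) ` Y"
  have compl: "- {i. i \<notin> range (inc y)} = range (inc y)" for y by auto
  have X: "|X| <o |D|" unfolding X_def by (rule ordLeq_ordLess_trans[OF card_of_image small])
  have power: "|PiE {..<n::nat} (\<lambda>_. X)| <o |D|" for n
  proof (cases "finite X")
    case True
    then have "finite (PiE {..<n} (\<lambda>_. X))" by (simp add: finite_PiE)
    then show ?thesis using D(2) by (rule finite_card_ordLess)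
  next
    case False
    then show ?thesis by (rule ordLeq_ordLess_trans[OF card_PiE_ordLeq[OF _ finite_lessThan] X])
  qed
  have "\<not> dominating (\<phi> ` PiE {..<n} (\<lambda>_. X))" for \<phi> and n :: nat
    using D(1) ordLeq_ordLess_trans[OF card_of_image power[of n], of \<phi>] not_ordLess_ordLeq by blast
  moreover have "bounded_wrt (le_sf \<S>) (\<phi> ` X)" for \<phi>
    by (rule B[OF ordLeq_ordLess_trans[OF card_of_image X]])
  moreover have "infinite (- Collect x)" if "x \<in> X" for x
  proof -
    obtain y where "x = (\<lambda>i. i \<notin> range (inc y))" using \<open>x \<in> X\<close> unfolding X_def by blast
    then have "- Collect x = range (inc y)" using compl by simp
    then show ?thesis
      using range_inj_infinite[OF strict_mono_imp_inj_on[OF inc]] by simp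
  qed
  moreover have "\<not> bounded_wrt le_star ((\<lambda>x. enum (- Collect x)) ` X)"
  proof
    assume "bounded_wrt le_star ((\<lambda>x. enum (- Collect x)) ` X)"
    then obtain h where "\<And>y. y \<in> Y \<Longrightarrow> le_star (enum (- {i. i \<notin> range (inc y)})) h"
      unfolding bounded_wrt_def X_def by blast
    then have "le_star (inc y) h" if "y \<in> Y" for y
      using that enum_range[OF inc] unfolding compl by (simp add: le_star_def)
    then have "bounded_wrt le_star Y"
      unfolding bounded_wrt_def using le_inc le_star_trans by blast
    then show False using unbounded by contradiction
  qed
  ultimately show ?thesis unfolding cantor_witness_def by blast
qed

section \<open>Choice of the case and transfer along the embedding\<close>

theorem theorem9p1:
  fixes P :: "'a topology" and \<S> :: "nat set set"
  assumes "topspace P \<noteq> {}"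
    and "polish P"
    and "nowhere_locally_compact P"
    and "nonmeager_bounding \<S>"
    and "bounding_number \<S> =o dominating_number"
  shows "\<exists>X\<subseteq>topspace P.
           (\<forall>n. menger (power_topology (subtopology P X) n)) \<and>
           satisfies_B \<S> (subtopology P X) \<and>
           \<not> hurewicz (subtopology P X)"
proof -
  have S: "semifilter \<S>" using assms(4) by (simp add: nonmeager_bounding_def)
  obtain D where D: "dominating D" "dominating_number = |D|" "\<And>C. dominating C \<Longrightarrow> |D| \<le>o |C|"
    by (rule min_card_attained[of dominating, OF dominating_UNIV, folded dominating_number_def]) (rule that)
  obtain U where U: "\<not> bounded_wrt (le_sf \<S>) U" "bounding_number \<S> = |U|"
    "\<And>C. \<not> bounded_wrt (le_sf \<S>) C \<Longrightarrow> |U| \<le>o |C|"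
    unfolding bounding_number_def
    using min_card_attained[of "\<lambda>Y. \<not> bounded_wrt (le_sf \<S>) Y", OF unbounded_UNIV[OF S]] by metis
  have UD: "|D| =o |U|" using assms(5) unfolding D(2) U(2) by (rule ordIso_symmetric)
  have inf: "infinite D" using D(1) by (rule dominating_infinite)
  obtain X where X: "cantor_witness \<S> X"
  proof (cases "\<exists>Y :: (nat \<Rightarrow> nat) set. |Y| <o |D| \<and> \<not> bounded_wrt le_star Y")
    case True
    \<comment> \<open>A family smaller than \<open>D\<close> is smaller than \<open>U\<close>, the
      least family unbounded for \<open>\<S>\<close>.\<close>
    have "bounded_wrt (le_sf \<S>) C" if "|C| <o |D|" for C :: "(nat \<Rightarrow> nat) set"
      using U(3) ordLess_ordIso_trans[OF that UD] not_ordLess_ordLeq by blast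
    then show ?thesis using that True cantor_witness_small[OF _ _ D(3) inf] by blast
  next
    case False
    \<comment> \<open>A singleton is enough, since \<open>exists_scale\<close> combines the lower
      bounds of each stage into one function.\<close>
    have "\<not> meager_in increasing_baire_space {g. strict_mono g \<and> le_sf \<S> y g}" for y
    proof -
      have "|{y}| <o bounding_number \<S>"
        unfolding U(2) by (rule ordLess_ordIso_trans[OF finite_card_ordLess UD]) (use inf in auto)
      then show ?thesis using assms(4) unfolding nonmeager_bounding_def by fastforce
    qed
    then show ?thesis using that False cantor_witness_concentrated[OF S D(1)] by blast
  qed
  obtain e :: "(nat \<Rightarrow> bool) \<Rightarrow> 'a" where "embedding_map sequence_space P e"
    using cantor_embedding assms(1-3) unfolding polish_def by blast
  then obtain e' where maps: "homeomorphic_maps sequence_space (subtopology P (range e)) e e'"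
    unfolding embedding_map_def homeomorphic_map_maps by auto
  have e: "continuous_map sequence_space P e" "\<And>x. e' (e x) = x"
    and e': "continuous_map (subtopology P (range e)) sequence_space e'"
    using maps unfolding homeomorphic_maps_def continuous_map_in_subtopology by auto
  have range_e: "range e \<subseteq> topspace P"
    using continuous_map_image_subset_topspace[OF e(1)] by simp
  let ?X = "subtopology sequence_space X" and ?P = "subtopology P (e ` X)"
  have eX: "continuous_map ?X ?P e"
    unfolding continuous_map_in_subtopology using e(1) by (auto intro: continuous_map_from_subtopology)
  have topP: "topspace ?P = e ` X" using range_e by auto
  have "menger (power_topology ?P n)" for n
    unfolding menger_def power_topology_def
  proof (intro allI impI notI)
    fix \<phi> assume \<phi>: "continuous_map (product_topology (\<lambda>_. ?P) {..<n}) baire_space \<phi>"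
      and dom: "dominating (\<phi> ` topspace (product_topology (\<lambda>_. ?P) {..<n}))"
    let ?e = "\<lambda>x. \<lambda>i\<in>{..<n}. e (x i)"
    have "continuous_map (product_topology (\<lambda>_. ?X) {..<n}) (product_topology (\<lambda>_. ?P) {..<n}) ?e"
      unfolding continuous_map_componentwise
    proof (intro conjI ballI)
      fix i assume i: "i \<in> {..<n}"
      have "continuous_map (product_topology (\<lambda>_. ?X) {..<n}) ?P (e \<circ> (\<lambda>x. x i))"
        using continuous_map_product_projection[OF i] eX by (rule continuous_map_compose)
      then show "continuous_map (product_topology (\<lambda>_. ?X) {..<n}) ?P (\<lambda>x. ?e x i)"
        using i by (simp add: o_def)
    qed auto
    then have "continuous_map (product_topology (\<lambda>_. ?X) {..<n}) baire_space (\<phi> \<circ> ?e)"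
      using \<phi> by (rule continuous_map_compose)
    then have "\<not> dominating ((\<phi> \<circ> ?e) ` PiE {..<n} (\<lambda>_. X))"
      by (rule cantor_witness_not_dominating[OF X])
    moreover
    \<comment> \<open>Every point of the power in \<open>P\<close> has a preimage, taken
      coordinatewise by \<open>e'\<close>; outside the index set both sides have the default value
      of extensional functions.\<close>
    have "topspace (product_topology (\<lambda>_. ?P) {..<n}) \<subseteq> ?e ` PiE {..<n} (\<lambda>_. X)"
    proof
      fix y assume "y \<in> topspace (product_topology (\<lambda>_. ?P) {..<n})"
      then have y: "y \<in> PiE {..<n} (\<lambda>_. e ` X)" by (simp only: topspace_product_topology topP)
      have "e' q \<in> X" "e (e' q) = q" if "q \<in> e ` X" for q
        using that e(2) by auto
      note inv = this
      define x where "x = (\<lambda>i\<in>{..<n}. e' (y i))"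
      have x: "x \<in> PiE {..<n} (\<lambda>_. X)"
        unfolding x_def restrict_PiE_iff using inv(1)[OF PiE_mem[OF y]] by blast
      have "?e x i = y i" for i
      proof (cases "i \<in> {..<n}")
        case True
        then have "?e x i = e (e' (y i))" by (simp add: x_def)
        also have "\<dots> = y i" using PiE_mem[OF y True] by (rule inv(2))
        finally show ?thesis .
      next
        case False
        then show ?thesis using PiE_arb[OF y False] by simp
      qed
      then have "?e x = y" by (rule ext)
      with x show "y \<in> ?e ` PiE {..<n} (\<lambda>_. X)" by blast
    qed
    then have "\<phi> ` topspace (product_topology (\<lambda>_. ?P) {..<n}) \<subseteq> (\<phi> \<circ> ?e) ` PiE {..<n} (\<lambda>_. X)"
      unfolding image_comp[symmetric] by (rule image_mono)
    then have "dominating ((\<phi> \<circ> ?e) ` PiE {..<n} (\<lambda>_. X))" using dom by (rule dominating_mono)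
    ultimately show False by contradiction
  qed
  moreover have "satisfies_B \<S> ?P"
    unfolding satisfies_B_def
  proof (intro allI impI)
    fix \<phi> assume "continuous_map ?P baire_space \<phi>"
    with eX have "continuous_map ?X baire_space (\<phi> \<circ> e)" by (rule continuous_map_compose)
    then have "bounded_wrt (le_sf \<S>) ((\<phi> \<circ> e) ` X)" by (rule cantor_witness_bounded[OF X])
    then show "bounded_wrt (le_sf \<S>) (\<phi> ` topspace ?P)" by (simp only: topP image_comp)
  qed
  moreover have "\<not> hurewicz ?P"
  proof
    assume hur: "hurewicz ?P"
    have "continuous_map ?P sequence_space e'"
      by (rule continuous_map_from_subtopology_mono[OF e']) blast
    then have "continuous_map ?P ?X e'"
      unfolding continuous_map_in_subtopology using e(2) topP by auto
    \<comment> \<open>Composed with the inverse of the embedding, enumeration of complements is a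
      continuous map on the copy of \<open>X\<close> in \<open>P\<close>, with the same unbounded
      image.\<close>
    moreover have "continuous_map ?X baire_space (\<lambda>x. enum (- Collect x))"
      by (rule continuous_map_enum_complement) (rule cantor_witness_infinite_complement[OF X])
    ultimately have "continuous_map ?P baire_space ((\<lambda>x. enum (- Collect x)) \<circ> e')"
      by (rule continuous_map_compose)
    then have "bounded_wrt le_star (((\<lambda>x. enum (- Collect x)) \<circ> e') ` topspace ?P)"
      using hur unfolding hurewicz_def by (elim allE impE)
    moreover have "((\<lambda>x. enum (- Collect x)) \<circ> e') ` (e ` X) = (\<lambda>x. enum (- Collect x)) ` X"
      by (simp add: image_image e(2))
    ultimately have "bounded_wrt le_star ((\<lambda>x. enum (- Collect x)) ` X)" by (simp only: topP)
    then show False using cantor_witness_unbounded[OF X] by contradiction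
  qed
  moreover have "e ` X \<subseteq> topspace P" using range_e by blast
  ultimately show ?thesis by blast
qed

end
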